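(* Let $G$ be a locally compact second countable group acting quasi-invariantly on $(X,\nu)$ and let $\varphi:X\to S(G)$ be a $G$-equivariant measurable map such that $\mathrm{stab}(x)\subseteq\varphi(x)$ for $\nu$-almost every $x\in X$. Let $(Z,\zeta)$ be the quotient space of $(X,\nu)$ over $\varphi$ and let $\psi:(X,\nu)\to(Z,\zeta)$ be the corresponding $G$-map. Then $\varphi(x)\subseteq\mathrm{stab}(\psi(x))$ for $\nu$-almost every $x\in X$. Moreover, the quotient space has the following universal property: if $\pi:(X,\nu)\to(Y,\eta)$ is a $G$-map of $G$-spaces such that $\varphi(x)\subseteq\mathrm{stab}(\pi(x))$ for $\nu$-almost every $x\in X$, then there exist $G$-maps $\psi:(X,\nu)\to(Z,\zeta)$ and $\tau:(Z,\zeta)\to(Y,\eta)$ such that $\tau\circ\psi=\pi$.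
   Context: A $G$-space is a (standard) probability space $(X,\nu)$ with a measurable quasi-invariant action of $G$ (null sets are preserved). A $G$-map $\pi:(X,\nu)\to(Y,\eta)$ is a measurable map with $\pi_*\nu=\eta$ and $\pi(gx)=g\pi(x)$ for all $g$ and almost every $x$. $S(G)$ is the space of closed subgroups of $G$ with the Chabauty topology and conjugation action; $\mathrm{stab}(x)=\{g\in G:gx=x\}$. For $\varphi$ as in the claim, $f\in L^\infty(X,\nu)$ is $\varphi$-invariant when for almost every $x\in X$ and all $g\in\varphi(x)$, $f(gx)=f(x)$. The $\varphi$-invariant functions form a closed $G$-invariant subalgebra of $L^\infty(X,\nu)$, and the quotient space of $(X,\nu)$ over $\varphi$ is the Mackey point realization of this subalgebra: a $G$-space $(Z,\zeta)$ with a $G$-map $\psi:(X,\nu)\to(Z,\zeta)$ such that the subalgebra equals $\{F\circ\psi:F\in L^\infty(Z,\zeta)\}$. *)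

theory Defs
  imports "HOL-Probability.Probability"
begin

text \<open>Groups are written additively, following the library class
  \<^class>\<open>topological_group_add\<close>; it extends \<^class>\<open>group_add\<close>, so the group is
  not assumed to be commutative.\<close>

subsection \<open>The space of closed subgroups\<close>

definition closed_subgroups :: "'g::topological_group_add set set" where
  "closed_subgroups =
     {H. closed H \<and> 0 \<in> H \<and> (\<forall>a\<in>H. \<forall>b\<in>H. a + b \<in> H) \<and> (\<forall>a\<in>H. - a \<in> H)}"

definition chabauty_topology :: "'g::topological_group_add set topology" where
  "chabauty_topology =
     subtopology
       (topology_generated_by
          ({{H. H \<inter> K = {}} |K. compact K} \<union> {{H. H \<inter> U \<noteq> {}} |U. open U}))
       closed_subgroups"

definition chabauty_borel :: "'g::topological_group_add set measure" where
  "chabauty_borel = sigma closed_subgroups {W. openin chabauty_topology W}"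

definition conj_subgroup :: "'g::group_add \<Rightarrow> 'g set \<Rightarrow> 'g set" where
  "conj_subgroup g H = (\<lambda>h. g + h - g) ` H"

lemma topspace_chabauty_topology [simp]:
  "topspace (chabauty_topology :: 'g::topological_group_add set topology) = closed_subgroups"
proof -
  have "UNIV \<in> {{H::'g set. H \<inter> K = {}} |K. compact K}"
    by (rule CollectI, rule exI[of _ "{}"]) simp
  then have "\<Union>({{H::'g set. H \<inter> K = {}} |K. compact K} \<union>
      {{H. H \<inter> U \<noteq> {}} |U. open U}) = UNIV"
    by blast
  then show ?thesis
    unfolding chabauty_topology_def topspace_subtopology topology_generated_by_topspace
    by (metis Int_UNIV_left)
qed

subsection \<open>\<open>G\<close>-spaces and \<open>G\<close>-maps\<close>

definition standard_borel :: "'x measure \<Rightarrow> bool" where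
  "standard_borel M \<longleftrightarrow>
     (\<exists>T. completely_metrizable_space T \<and> second_countable T \<and> topspace T = space M \<and>
          sets M = sigma_sets (space M) {U. openin T U})"

locale G_space = prob_space M
  for act :: "'g::topological_group_add \<Rightarrow> 'x \<Rightarrow> 'x" and M :: "'x measure" +
  assumes standard_borel: "standard_borel M"
    and act_measurable: "(\<lambda>(g, x). act g x) \<in> measurable (borel \<Otimes>\<^sub>M M) M"
    and act_zero: "x \<in> space M \<Longrightarrow> act 0 x = x"
    and act_add: "x \<in> space M \<Longrightarrow> act (g + h) x = act g (act h x)"
    and act_quasi_invariant: "N \<in> null_sets M \<Longrightarrow> act g -` N \<inter> space M \<in> null_sets M"

definition stab :: "('g \<Rightarrow> 'x \<Rightarrow> 'x) \<Rightarrow> 'x \<Rightarrow> 'g set" where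
  "stab act x = {g. act g x = x}"

text \<open>The exceptional null set in the equivariance condition may depend on the group element.\<close>

definition G_map ::
  "('g \<Rightarrow> 'x \<Rightarrow> 'x) \<Rightarrow> 'x measure \<Rightarrow> ('g \<Rightarrow> 'y \<Rightarrow> 'y) \<Rightarrow> 'y measure \<Rightarrow> ('x \<Rightarrow> 'y) \<Rightarrow> bool" where
  "G_map actX X actY Y \<pi> \<longleftrightarrow>
     \<pi> \<in> measurable X Y \<and> distr X Y \<pi> = Y \<and>
     (\<forall>g. AE x in X. \<pi> (actX g x) = actY g (\<pi> x))"

subsection \<open>The quotient space over \<open>\<phi>\<close>\<close>

definition Linfty :: "'x measure \<Rightarrow> ('x \<Rightarrow> real) set" where
  "Linfty M = {f \<in> borel_measurable M. \<exists>C. AE x in M. \<bar>f x\<bar> \<le> C}"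

definition phi_invariant ::
  "('g \<Rightarrow> 'x \<Rightarrow> 'x) \<Rightarrow> 'x measure \<Rightarrow> ('x \<Rightarrow> 'g set) \<Rightarrow> ('x \<Rightarrow> real) \<Rightarrow> bool" where
  "phi_invariant act M \<phi> f \<longleftrightarrow> (AE x in M. \<forall>g\<in>\<phi> x. f (act g x) = f x)"

text \<open>Elements of \<open>L\<^sup>\<infinity>\<close> are classes of functions modulo null sets, whereas the condition
  \<^const>\<open>phi_invariant\<close> is sensitive to the choice of representative: \<open>\<phi> x\<close> may be
  uncountable, so altering \<open>f\<close> on a null set can alter \<open>f (act g x)\<close> for some \<open>g \<in> \<phi> x\<close> at
  every \<open>x\<close>.  A class is invariant if one of its representatives is; the set below is the
  union of the invariant classes.\<close>

definition invariant_algebra ::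
  "('g \<Rightarrow> 'x \<Rightarrow> 'x) \<Rightarrow> 'x measure \<Rightarrow> ('x \<Rightarrow> 'g set) \<Rightarrow> ('x \<Rightarrow> real) set" where
  "invariant_algebra act M \<phi> =
     {f \<in> Linfty M. \<exists>f'\<in>Linfty M. (AE x in M. f x = f' x) \<and> phi_invariant act M \<phi> f'}"

definition quotient_space ::
  "('g::topological_group_add \<Rightarrow> 'x \<Rightarrow> 'x) \<Rightarrow> 'x measure \<Rightarrow> ('x \<Rightarrow> 'g set) \<Rightarrow>
   ('g \<Rightarrow> 'z \<Rightarrow> 'z) \<Rightarrow> 'z measure \<Rightarrow> ('x \<Rightarrow> 'z) \<Rightarrow> bool" where
  "quotient_space actX X \<phi> actZ Z \<psi> \<longleftrightarrow>
     G_space actZ Z \<and> G_map actX X actZ Z \<psi> \<and>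
     invariant_algebra actX X \<phi> = {f \<in> Linfty X. \<exists>F\<in>Linfty Z. AE x in X. f x = F (\<psi> x)}"

end

theory Submission
  imports Defs
begin

text \<open>
  The action and the \<open>G\<close>-maps interact only almost everywhere, with a null set that depends on the
  group element, whereas the subgroups \<open>\<phi> x\<close> are usually null in \<open>G\<close>.  The bridge between the two
  is a probability measure \<open>p\<close> on \<open>G\<close> whose null sets are preserved by right translations
  (\<open>exists_right_quasi_invariant_prob\<close>).  By Fubini, a property that holds at almost every point of
  \<open>X\<close> holds at \<open>h x\<close> for \<open>p\<close>-almost every \<open>h\<close>, for almost every \<open>x\<close>; right translation by an
  arbitrary \<open>g\<close> then makes it hold at \<open>h g x\<close> as well, with no null set of exceptional \<open>g\<close>.
  The group operation is written multiplicatively in this overview and additively elsewhere.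

  The measure \<open>p\<close> is a right Haar measure reweighted to total mass one.  Following Weil, the numbers of
  right translates of a small neighbourhood needed to cover compact sets, suitably normalised, have
  a cluster point as the neighbourhood shrinks; it is an invariant content
  (\<open>exists_right_invariant_content\<close>), and Caratheodory's theorem turns it into a measure.

  For a \<open>G\<close>-map \<open>\<pi>\<close> into a \<open>G\<close>-space \<open>Y\<close> two conditions are shown to be equivalent: that
  \<open>\<phi> x\<close> fixes \<open>\<pi> x\<close> for almost every \<open>x\<close>, and that every bounded function of \<open>\<pi>\<close> lies in the
  invariant algebra.

  \<^item> If the functions of \<open>\<pi>\<close> are invariant (\<open>AE_subset_stab_if_invariant\<close>), take strictly invariant
    representatives of a countable family of them that separates the points of \<open>Y\<close>.  For
    \<open>g \<in> \<phi> x\<close> choose \<open>h\<close> such that both \<open>h x\<close> and \<open>h g x\<close> are generic.  The element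
    \<open>h g h\<^sup>-\<^sup>1\<close> of \<open>\<phi> (h x)\<close> moves \<open>h x\<close> to \<open>h g x\<close>, so these two points have the same image, which
    means \<open>h g \<pi> x = h \<pi> x\<close>.

  \<^item> If \<open>\<phi> x\<close> fixes \<open>\<pi> x\<close> (\<open>invariant_if_AE_subset_stab\<close>), the \<open>p\<close>-average over \<open>h\<close> of
    \<open>F (h\<^sup>-\<^sup>1 \<pi> (h x))\<close> is a representative of \<open>F \<circ> \<pi>\<close> that is invariant for every \<open>g \<in> \<phi> x\<close>.

  The first direction, applied to \<open>\<psi>\<close>, gives the inclusion into the stabiliser.  The second one
  shows that every bounded function of \<open>\<pi>\<close> is a function of \<open>\<psi>\<close>.  Since a point of the Polish space
  \<open>Y\<close> is determined by its distances to a dense sequence, and the sequences of numbers that arise as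
  such distances are described by countably many inequalities, this yields the map \<open>\<tau>\<close>
  (\<open>G_map_factorization\<close>).
\<close>

section \<open>Covering a compact set by right translates\<close>

text \<open>Weil's index \<open>(K : U)\<close>, with an unspecified value if finitely many translates do not suffice.\<close>
definition right_cover_number :: "'g::group_add set \<Rightarrow> 'g set \<Rightarrow> nat" where
  "right_cover_number K U =
     (LEAST n. \<exists>F. finite F \<and> card F = n \<and> K \<subseteq> (\<Union>h\<in>F. (\<lambda>u. u + h) ` U))"

lemma image_right_translation_eq_vimage:
  fixes U :: "'g::group_add set"
  shows "(\<lambda>u. u + h) ` U = (\<lambda>x. x - h) -` U"
proof (intro equalityI subsetI)
  fix x assume "x \<in> (\<lambda>x. x - h) -` U"
  then show "x \<in> (\<lambda>u. u + h) ` U"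
    by (intro image_eqI[of _ _ "x - h"]) auto
qed auto

lemma open_right_translation:
  fixes U :: "'g::topological_group_add set"
  assumes "open U"
  shows "open ((\<lambda>u. u + h) ` U)"
proof -
  have "continuous_on UNIV (\<lambda>x::'g. x + - h)"
    by (intro continuous_on_add continuous_on_id continuous_on_const)
  then show ?thesis
    using assms by (simp add: image_right_translation_eq_vimage open_vimage)
qed

lemma compact_right_translation:
  fixes K :: "'g::topological_group_add set"
  assumes "compact K"
  shows "compact ((\<lambda>u. u + h) ` K)"
  by (intro compact_continuous_image continuous_on_add continuous_on_id continuous_on_const assms)

lemma compact_finite_right_cover:
  fixes K :: "'g::topological_group_add set"
  assumes "compact K" "open U" "0 \<in> U"
  shows "\<exists>F. finite F \<and> K \<subseteq> (\<Union>h\<in>F. (\<lambda>u. u + h) ` U)"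
proof -
  have "K \<subseteq> (\<Union>h\<in>K. (\<lambda>u. u + h) ` U)"
    using \<open>0 \<in> U\<close> by force
  then show ?thesis
    using compactE_image[OF \<open>compact K\<close>, of K "\<lambda>h. (\<lambda>u. u + h) ` U"]
      open_right_translation[OF \<open>open U\<close>] by metis
qed

lemma right_cover_number_le:
  assumes "finite F" "K \<subseteq> (\<Union>h\<in>F. (\<lambda>u. u + h) ` U)"
  shows "right_cover_number K U \<le> card F"
  unfolding right_cover_number_def using assms by (intro Least_le) blast

lemma right_cover_number_attained:
  fixes K :: "'g::topological_group_add set"
  assumes "compact K" "open U" "0 \<in> U"
  obtains F where "finite F" "card F = right_cover_number K U"
    "K \<subseteq> (\<Union>h\<in>F. (\<lambda>u. u + h) ` U)"
proof -
  have "\<exists>n F. finite F \<and> card F = n \<and> K \<subseteq> (\<Union>h\<in>F. (\<lambda>u. u + h) ` U)"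
    using compact_finite_right_cover[OF assms] by blast
  then have "\<exists>F. finite F \<and> card F = right_cover_number K U \<and> K \<subseteq> (\<Union>h\<in>F. (\<lambda>u. u + h) ` U)"
    unfolding right_cover_number_def by (rule LeastI_ex)
  then show ?thesis
    using that by blast
qed

lemma right_cover_number_mono:
  fixes K L :: "'g::topological_group_add set"
  assumes "compact L" "open U" "0 \<in> U" "K \<subseteq> L"
  shows "right_cover_number K U \<le> right_cover_number L U"
proof -
  obtain F where "finite F" "card F = right_cover_number L U" "L \<subseteq> (\<Union>h\<in>F. (\<lambda>u. u + h) ` U)"
    using right_cover_number_attained[OF assms(1-3)] .
  then show ?thesis
    using right_cover_number_le[of F K U] \<open>K \<subseteq> L\<close> by auto
qed

lemma right_cover_number_Un_le:
  fixes K L :: "'g::topological_group_add set"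
  assumes "compact K" "compact L" "open U" "0 \<in> U"
  shows "right_cover_number (K \<union> L) U \<le> right_cover_number K U + right_cover_number L U"
proof -
  obtain F1 where F1: "finite F1" "card F1 = right_cover_number K U"
      "K \<subseteq> (\<Union>h\<in>F1. (\<lambda>u. u + h) ` U)"
    using right_cover_number_attained[OF assms(1,3,4)] .
  obtain F2 where F2: "finite F2" "card F2 = right_cover_number L U"
      "L \<subseteq> (\<Union>h\<in>F2. (\<lambda>u. u + h) ` U)"
    using right_cover_number_attained[OF assms(2-4)] .
  have "right_cover_number (K \<union> L) U \<le> card (F1 \<union> F2)"
    using F1 F2 by (intro right_cover_number_le) auto
  also have "\<dots> \<le> card F1 + card F2"
    by (rule card_Un_le)
  finally show ?thesis
    using F1 F2 by simp
qed

text \<open>If no translate of \<open>U\<close> meets both sets, an optimal cover of the union splits into a cover of each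
  set.  This is the only source of additivity in the construction.\<close>
lemma right_cover_number_Un_separated:
  fixes K L :: "'g::topological_group_add set"
  assumes "compact K" "compact L" "open U" "0 \<in> U"
    and separated: "\<And>u v h. u \<in> U \<Longrightarrow> v \<in> U \<Longrightarrow> u + h \<in> K \<Longrightarrow> v + h \<in> L \<Longrightarrow> False"
  shows "right_cover_number (K \<union> L) U = right_cover_number K U + right_cover_number L U"
proof (rule antisym)
  show "right_cover_number (K \<union> L) U \<le> right_cover_number K U + right_cover_number L U"
    using assms(1-4) by (rule right_cover_number_Un_le)
  obtain F where F: "finite F" "card F = right_cover_number (K \<union> L) U"
      "K \<union> L \<subseteq> (\<Union>h\<in>F. (\<lambda>u. u + h) ` U)"
    using right_cover_number_attained[of "K \<union> L" U] assms by (metis compact_Un)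
  define FK where "FK = {h\<in>F. (\<lambda>u. u + h) ` U \<inter> K \<noteq> {}}"
  define FL where "FL = {h\<in>F. (\<lambda>u. u + h) ` U \<inter> L \<noteq> {}}"
  have fin: "finite FK" "finite FL" and sub: "FK \<union> FL \<subseteq> F"
    using F(1) by (auto simp: FK_def FL_def)
  have "K \<subseteq> (\<Union>h\<in>FK. (\<lambda>u. u + h) ` U)" "L \<subseteq> (\<Union>h\<in>FL. (\<lambda>u. u + h) ` U)"
    using F(3) by (auto simp: FK_def FL_def subset_iff) (metis Int_iff empty_iff imageI)+
  then have "right_cover_number K U + right_cover_number L U \<le> card FK + card FL"
    using fin by (intro add_mono right_cover_number_le)
  also have "\<dots> = card (FK \<union> FL)"
    using fin separated by (intro card_Un_disjoint[symmetric]) (auto simp: FK_def FL_def)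
  also have "\<dots> \<le> card F"
    using F(1) sub by (rule card_mono)
  finally show "right_cover_number K U + right_cover_number L U \<le> right_cover_number (K \<union> L) U"
    using F(2) by simp
qed

lemma right_cover_number_translate:
  fixes K :: "'g::topological_group_add set"
  assumes "compact K" "open U" "0 \<in> U"
  shows "right_cover_number ((\<lambda>u. u + g) ` K) U = right_cover_number K U"
proof -
  have le: "right_cover_number ((\<lambda>u. u + a) ` L) U \<le> right_cover_number L U"
    if L: "compact L" for a and L :: "'g set"
  proof -
    obtain F where F: "finite F" "card F = right_cover_number L U"
        "L \<subseteq> (\<Union>h\<in>F. (\<lambda>u. u + h) ` U)"
      using right_cover_number_attained[OF L assms(2,3)] .
    have "(\<lambda>u. u + a) ` L \<subseteq> (\<Union>h\<in>(\<lambda>h. h + a) ` F. (\<lambda>u. u + h) ` U)"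
      using F(3) by (force simp: add.assoc)
    then have "right_cover_number ((\<lambda>u. u + a) ` L) U \<le> card ((\<lambda>h. h + a) ` F)"
      using F(1) by (intro right_cover_number_le) auto
    also have "\<dots> \<le> card F"
      using F(1) by (rule card_image_le)
    finally show ?thesis
      using F(2) by simp
  qed
  have "(\<lambda>u. u + - g) ` (\<lambda>u. u + g) ` K = K"
    by (auto simp: image_image)
  then have "right_cover_number K U \<le> right_cover_number ((\<lambda>u. u + g) ` K) U"
    using le[OF compact_right_translation[OF assms(1), of g], of "- g"] by simp
  then show ?thesis
    using le[OF assms(1), of g] by simp
qed

text \<open>Covering \<open>K\<close> by translates of \<open>V\<close>, and each of these by translates of \<open>U\<close>, bounds the
  normalised cover numbers of \<open>K\<close> independently of \<open>U\<close>.\<close>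
lemma right_cover_number_submult:
  fixes K C :: "'g::topological_group_add set"
  assumes "compact K" "compact C" "open U" "0 \<in> U" "open V" "0 \<in> V" "V \<subseteq> C"
  shows "right_cover_number K U \<le> right_cover_number K V * right_cover_number C U"
proof -
  obtain F1 where F1: "finite F1" "card F1 = right_cover_number K V"
      "K \<subseteq> (\<Union>h\<in>F1. (\<lambda>u. u + h) ` V)"
    using right_cover_number_attained[OF assms(1,5,6)] .
  obtain F2 where F2: "finite F2" "card F2 = right_cover_number C U"
      "C \<subseteq> (\<Union>h\<in>F2. (\<lambda>u. u + h) ` U)"
    using right_cover_number_attained[OF assms(2-4)] .
  have "K \<subseteq> (\<Union>h\<in>(\<lambda>(a, b). b + a) ` (F1 \<times> F2). (\<lambda>u. u + h) ` U)"
  proof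
    fix x assume "x \<in> K"
    then obtain a v where a: "a \<in> F1" "v \<in> V" "x = v + a"
      using F1(3) by blast
    then obtain b u where "b \<in> F2" "u \<in> U" "v = u + b"
      using F2(3) \<open>V \<subseteq> C\<close> by blast
    then show "x \<in> (\<Union>h\<in>(\<lambda>(a, b). b + a) ` (F1 \<times> F2). (\<lambda>u. u + h) ` U)"
      using a by (force simp: add.assoc)
  qed
  then have "right_cover_number K U \<le> card ((\<lambda>(a, b). b + a) ` (F1 \<times> F2))"
    using F1(1) F2(1) by (intro right_cover_number_le) auto
  also have "\<dots> \<le> card (F1 \<times> F2)"
    using F1(1) F2(1) by (intro card_image_le) auto
  finally show ?thesis
    using F1(2) F2(2) by (simp add: card_cartesian_product)
qed

lemma right_cover_number_pos:
  fixes K :: "'g::topological_group_add set"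
  assumes "compact K" "open U" "0 \<in> U" "K \<noteq> {}"
  shows "right_cover_number K U > 0"
proof -
  obtain F where F: "finite F" "card F = right_cover_number K U"
      "K \<subseteq> (\<Union>h\<in>F. (\<lambda>u. u + h) ` U)"
    using right_cover_number_attained[OF assms(1-3)] .
  have "F \<noteq> {}"
    using F(3) \<open>K \<noteq> {}\<close> by auto
  then show ?thesis
    using F(1,2) by (metis card_gt_0_iff)
qed

text \<open>By Tychonoff's theorem the sequence has a cluster point in the product of the intervals.  A closed
  set that eventually contains the sequence contains every cluster point, so closed conditions can be
  transferred without choosing a convergent subsequence.\<close>
lemma bounded_family_cluster_point:
  fixes r :: "nat \<Rightarrow> 'a \<Rightarrow> real"
  assumes "\<And>n i. r n i \<in> {0..b i}"
  obtains l where "\<And>C. closed C \<Longrightarrow> eventually (\<lambda>n. r n \<in> C) sequentially \<Longrightarrow> l \<in> C"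
proof -
  have "compactin (product_topology (\<lambda>i. euclidean) UNIV) (Pi\<^sub>E UNIV (\<lambda>i. {0..b i}))"
    unfolding compactin_PiE by simp
  then have comp: "compact (Pi\<^sub>E UNIV (\<lambda>i. {0..b i}))"
    by (simp add: euclidean_product_topology)
  have "filtermap r sequentially \<noteq> bot"
    by (simp add: filtermap_bot_iff)
  moreover have "eventually (\<lambda>x. x \<in> Pi\<^sub>E UNIV (\<lambda>i. {0..b i})) (filtermap r sequentially)"
    unfolding eventually_filtermap using assms by (intro always_eventually allI PiE_I) auto
  ultimately obtain l where l: "inf (nhds l) (filtermap r sequentially) \<noteq> bot"
    using comp unfolding compact_filter by blast
  have "l \<in> C" if "closed C" "eventually (\<lambda>n. r n \<in> C) sequentially" for C
  proof (rule ccontr)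
    assume "l \<notin> C"
    then have "eventually (\<lambda>x. x \<in> - C) (nhds l)"
      using \<open>closed C\<close> by (intro eventually_nhds_in_open) auto
    then have "eventually (\<lambda>x. x \<in> - C) (inf (nhds l) (filtermap r sequentially))"
      by (rule filter_leD[OF inf_le1])
    moreover have "eventually (\<lambda>x. x \<in> C) (inf (nhds l) (filtermap r sequentially))"
      by (rule filter_leD[OF inf_le2]) (use that in \<open>simp add: eventually_filtermap\<close>)
    ultimately have "eventually (\<lambda>x. False) (inf (nhds l) (filtermap r sequentially))"
      by eventually_elim simp
    then show False
      using l by (simp add: trivial_limit_def)
  qed
  then show ?thesis
    using that by blast
qed

text \<open>The set of differences of \<open>K\<close> and \<open>L\<close> is compact and misses \<open>0\<close>, and \<open>(u + h) - (v + h) = u - v\<close>.\<close>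
lemma small_sets_separate_disjoint_compacts:
  fixes K L :: "'g::{topological_group_add, t2_space} set"
  assumes "compact K" "compact L" "K \<inter> L = {}"
  obtains U where "open U" "0 \<in> U"
    "\<And>u v h. u \<in> U \<Longrightarrow> v \<in> U \<Longrightarrow> u + h \<in> K \<Longrightarrow> v + h \<in> L \<Longrightarrow> False"
proof -
  define D where "D = (\<lambda>(k, l). k - l) ` (K \<times> L)"
  have cont: "continuous_on S (\<lambda>p::'g \<times> 'g. fst p + - snd p)" for S
    unfolding continuous_on_def
    by (intro ballI tendsto_add tendsto_minus tendsto_fst tendsto_snd tendsto_ident_at)
  then have "compact D"
    unfolding D_def case_prod_unfold diff_conv_add_uminus
    by (intro compact_continuous_image compact_Times assms(1,2))
  then have "open (- D)" "0 \<in> - D"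
    using assms(3) by (auto simp: D_def compact_imp_closed open_Compl)
  then have "open ((\<lambda>p. fst p + - snd p) -` (- D))" "(0, 0) \<in> (\<lambda>p. fst p + - snd p) -` (- D)"
    using cont by (auto intro: open_vimage)
  then obtain A B where "open A" "open B" "(0, 0) \<in> A \<times> B"
      "A \<times> B \<subseteq> (\<lambda>p. fst p + - snd p) -` (- D)"
    by (rule open_prod_elim)
  then have AB: "open A" "0 \<in> A" "open B" "0 \<in> B" "\<And>u v. u \<in> A \<Longrightarrow> v \<in> B \<Longrightarrow> u - v \<in> - D"
    by auto
  show ?thesis
  proof
    show "open (A \<inter> B)" "0 \<in> A \<inter> B"
      using AB by auto
    fix u v h assume uv: "u \<in> A \<inter> B" "v \<in> A \<inter> B" "u + h \<in> K" "v + h \<in> L"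
    then have "(u + h) - (v + h) \<in> D"
      by (auto simp: D_def)
    moreover have "(u + h) - (v + h) = u - v"
      by (simp add: diff_conv_add_uminus minus_add add.assoc del: add_uminus_conv_diff)
    ultimately show False
      using AB(5)[of u v] uv by auto
  qed
qed

text \<open>Weil's construction: the content is a cluster point of the cover numbers with respect to
  shrinking neighbourhoods of \<open>0\<close>, normalised by the cover number of \<open>C\<close>.  Right translates are
  counted, so right invariance holds already before passing to the limit.\<close>
lemma exists_right_invariant_content:
  fixes C :: "'g::{topological_group_add, first_countable_topology, t2_space} set"
  assumes C: "compact C" and V: "open V" "0 \<in> V" "V \<subseteq> C"
  obtains l :: "'g set \<Rightarrow> real" where
    "l C = 1"
    "\<And>K. compact K \<Longrightarrow> 0 \<le> l K"
    "\<And>K L. compact K \<Longrightarrow> compact L \<Longrightarrow> K \<subseteq> L \<Longrightarrow> l K \<le> l L"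
    "\<And>K L. compact K \<Longrightarrow> compact L \<Longrightarrow> l (K \<union> L) \<le> l K + l L"
    "\<And>K L. compact K \<Longrightarrow> compact L \<Longrightarrow> K \<inter> L = {} \<Longrightarrow> l (K \<union> L) = l K + l L"
    "\<And>K g. compact K \<Longrightarrow> l ((\<lambda>u. u + g) ` K) = l K"
proof -
  obtain U :: "nat \<Rightarrow> 'g set" where U: "\<And>n. open (U n)" "\<And>n. 0 \<in> U n"
      and small: "\<And>S. open S \<Longrightarrow> 0 \<in> S \<Longrightarrow> eventually (\<lambda>n. U n \<subseteq> S) sequentially"
    using countable_basis_at_decseq[of "0::'g"] by metis
  define N where "N = (\<lambda>K. \<lambda>n. real (right_cover_number K (U n)))"
  \<comment> \<open>Noncompact sets get the value \<open>0\<close>, which keeps every coordinate of the sequence bounded.\<close>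
  define r where "r = (\<lambda>n K. if compact K then N K n / N C n else 0)"
  have NC: "N C n > 0" for n
    using right_cover_number_pos[OF C U] V by (auto simp: N_def)
  have "r n K \<in> {0..real (right_cover_number K V)}" for n K
  proof (cases "compact K")
    case True
    have "N K n \<le> real (right_cover_number K V) * N C n"
      unfolding N_def of_nat_mult[symmetric] of_nat_le_iff
      by (rule right_cover_number_submult) (use True C U V in auto)
    then show ?thesis
      using True NC[of n] by (auto simp: r_def N_def field_simps)
  qed (auto simp: r_def)
  then obtain l where l: "\<And>S. closed S \<Longrightarrow> eventually (\<lambda>n. r n \<in> S) sequentially \<Longrightarrow> l \<in> S"
    using bounded_family_cluster_point[of r "\<lambda>K. real (right_cover_number K V)"] by blast
  \<comment> \<open>Every relation between finitely many values that is closed and holds along the sequence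
      passes to the cluster point.\<close>
  have coord: "continuous_on UNIV (\<lambda>f::'g set \<Rightarrow> real. f K)" for K
    by (rule continuous_on_product_coordinates)
  have le: "l K \<le> l L + l M" if "\<And>n. r n K \<le> r n L + r n M" for K L M
  proof -
    have "closed {f::'g set \<Rightarrow> real. f K \<le> f L + f M}"
      by (intro closed_Collect_le continuous_on_add coord)
    from l[OF this] show ?thesis
      using that by simp
  qed
  have eq: "l K = l L + l M" if "eventually (\<lambda>n. r n K = r n L + r n M) sequentially" for K L M
  proof -
    have "closed {f::'g set \<Rightarrow> real. f K = f L + f M}"
      by (intro closed_Collect_eq continuous_on_add coord)
    from l[OF this] show ?thesis
      using that by simp
  qed
  have r0: "r n {} = 0" for n
    using right_cover_number_le[of "{}" "{}" "U n"] by (auto simp: r_def N_def)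
  have l0: "l {} = 0"
    using eq[of "{}" "{}" "{}"] r0 by simp
  show ?thesis
  proof
    show "l C = 1"
    proof -
      have "closed {f::'g set \<Rightarrow> real. f C = 1}"
        by (intro closed_Collect_eq continuous_on_const coord)
      moreover have "r n C = 1" for n
        using C NC[of n] by (simp add: r_def)
      ultimately show ?thesis
        using l[of "{f. f C = 1}"] by simp
    qed
    show "0 \<le> l K" if "compact K" for K
    proof -
      have "closed {f::'g set \<Rightarrow> real. 0 \<le> f K}"
        by (intro closed_Collect_le continuous_on_const coord)
      moreover have "0 \<le> r n K" for n
        by (simp add: r_def N_def)
      ultimately show ?thesis
        using l[of "{f. 0 \<le> f K}"] by simp
    qed
    show "l K \<le> l L" if "compact K" "compact L" "K \<subseteq> L" for K L
    proof -
      have "r n K \<le> r n L + r n {}" for n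
        using that right_cover_number_mono[OF that(2) U that(3)] NC[of n]
        unfolding r0 by (auto simp: r_def N_def divide_right_mono)
      then show ?thesis
        using le[of K L "{}"] l0 by simp
    qed
    show "l (K \<union> L) \<le> l K + l L" if "compact K" "compact L" for K L
    proof (rule le)
      show "r n (K \<union> L) \<le> r n K + r n L" for n
        using that right_cover_number_Un_le[OF that U, of n] NC[of n] compact_Un[OF that]
        by (auto simp: r_def N_def divide_right_mono simp flip: add_divide_distrib of_nat_add)
    qed
    show "l (K \<union> L) = l K + l L" if KL: "compact K" "compact L" "K \<inter> L = {}" for K L
    proof (rule eq)
      obtain S where S: "open S" "0 \<in> S"
          "\<And>u v h. u \<in> S \<Longrightarrow> v \<in> S \<Longrightarrow> u + h \<in> K \<Longrightarrow> v + h \<in> L \<Longrightarrow> False"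
        using small_sets_separate_disjoint_compacts[OF KL] by blast
      show "eventually (\<lambda>n. r n (K \<union> L) = r n K + r n L) sequentially"
        using small[OF S(1,2)]
      proof eventually_elim
        case (elim n)
        have "right_cover_number (K \<union> L) (U n)
            = right_cover_number K (U n) + right_cover_number L (U n)"
          by (rule right_cover_number_Un_separated[OF KL(1,2) U]) (use elim S(3) in blast)
        then show ?case
          using KL compact_Un[OF KL(1,2)] by (simp add: r_def N_def add_divide_distrib)
      qed
    qed
    show "l ((\<lambda>u. u + g) ` K) = l K" if "compact K" for K g
    proof -
      have "r n ((\<lambda>u. u + g) ` K) = r n K + r n {}" for n
        unfolding r0 using that right_cover_number_translate[OF that U, of g n] compact_right_translation[OF that, of g]
        by (simp add: r_def N_def)
      then show ?thesis
        using eq[of "(\<lambda>u. u + g) ` K" K "{}"] l0 by simp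
    qed
  qed
qed

section \<open>From a content on compact sets to a Borel measure\<close>

lemma compact_subset_Un_open_split:
  fixes K :: "'a::t2_space set"
  assumes "compact K" "open U" "open V" "K \<subseteq> U \<union> V"
  obtains K1 K2 where "compact K1" "compact K2" "K1 \<subseteq> U" "K2 \<subseteq> V" "K = K1 \<union> K2"
proof -
  have "compact (K - U)" "compact (K - V)"
    using assms by (auto intro: compact_diff)
  moreover have "disjnt (K - U) (K - V)"
    using assms(4) by (auto simp: disjnt_def)
  ultimately obtain A B where AB: "open A" "open B" "K - U \<subseteq> A" "K - V \<subseteq> B" "disjnt A B"
    using Hausdorff_space_compact_separation[of euclidean "K - U" "K - V"]
    by (auto simp: Hausdorff_space_def disjnt_def separation_t2)
  show ?thesis
  proof
    show "compact (K - A)" "compact (K - B)"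
      using assms AB by (auto intro: compact_diff)
    show "K - A \<subseteq> U" "K - B \<subseteq> V" "K = (K - A) \<union> (K - B)"
      using AB by (auto simp: disjnt_def)
  qed
qed

definition inner_content :: "('a::topological_space set \<Rightarrow> real) \<Rightarrow> 'a set \<Rightarrow> ennreal" where
  "inner_content l U = (SUP K\<in>{K. compact K \<and> K \<subseteq> U}. ennreal (l K))"

definition outer_content :: "('a::topological_space set \<Rightarrow> real) \<Rightarrow> 'a set \<Rightarrow> ennreal" where
  "outer_content l A = (INF U\<in>{U. open U \<and> A \<subseteq> U}. inner_content l U)"

lemma inner_content_mono: "U \<subseteq> V \<Longrightarrow> inner_content l U \<le> inner_content l V"
  unfolding inner_content_def by (rule SUP_subset_mono) auto

lemma outer_content_open: "open U \<Longrightarrow> outer_content l U = inner_content l U"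
  unfolding outer_content_def
  by (intro antisym INF_lower INF_greatest) (auto intro: inner_content_mono)

lemma outer_content_mono: "A \<subseteq> B \<Longrightarrow> outer_content l A \<le> outer_content l B"
  unfolding outer_content_def by (rule INF_superset_mono) auto

lemma content_le_inner_content: "compact K \<Longrightarrow> K \<subseteq> U \<Longrightarrow> ennreal (l K) \<le> inner_content l U"
  unfolding inner_content_def by (rule SUP_upper) auto

locale content_on_compacts =
  fixes l :: "'a::t2_space set \<Rightarrow> real"
  assumes nonneg: "compact K \<Longrightarrow> 0 \<le> l K"
    and mono: "compact K \<Longrightarrow> compact L \<Longrightarrow> K \<subseteq> L \<Longrightarrow> l K \<le> l L"
    and subadditive: "compact K \<Longrightarrow> compact L \<Longrightarrow> l (K \<union> L) \<le> l K + l L"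
    and additive: "compact K \<Longrightarrow> compact L \<Longrightarrow> K \<inter> L = {} \<Longrightarrow> l (K \<union> L) = l K + l L"
begin

lemma content_empty: "l {} = 0"
  using additive[of "{}" "{}"] by simp

text \<open>Compactness makes finitely many open sets enough; the compact set is then cut into compact pieces,
  one inside each open set.\<close>
lemma content_le_sum_inner_content:
  fixes U :: "nat \<Rightarrow> 'a set"
  assumes "compact K" "\<And>n. open (U n)" "K \<subseteq> (\<Union>n<N. U n)"
  shows "ennreal (l K) \<le> (\<Sum>n<N. inner_content l (U n))"
  using assms(1,3)
proof (induction N arbitrary: K)
  case 0
  then show ?case
    by (simp add: content_empty)
next
  case (Suc N)
  have "K \<subseteq> (\<Union>n<N. U n) \<union> U N"
    using Suc.prems(2) by (force simp: less_Suc_eq)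
  then obtain K1 K2 where K: "compact K1" "compact K2" "K1 \<subseteq> (\<Union>n<N. U n)" "K2 \<subseteq> U N" "K = K1 \<union> K2"
    using compact_subset_Un_open_split[OF Suc.prems(1), of "\<Union>n<N. U n" "U N"] assms(2)
    by (auto simp: open_UN)
  have "ennreal (l K) \<le> ennreal (l K1 + l K2)"
    using subadditive[OF K(1,2)] K(5) by (simp add: ennreal_leI)
  also have "\<dots> = ennreal (l K1) + ennreal (l K2)"
    using K nonneg by (simp add: ennreal_plus)
  also have "\<dots> \<le> (\<Sum>n<N. inner_content l (U n)) + inner_content l (U N)"
    using K by (intro add_mono Suc.IH content_le_inner_content)
  finally show ?case
    by simp
qed

lemma inner_content_UN_le:
  fixes U :: "nat \<Rightarrow> 'a set"
  assumes "\<And>n. open (U n)"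
  shows "inner_content l (\<Union>n. U n) \<le> (\<Sum>n. inner_content l (U n))"
  unfolding inner_content_def[of l "\<Union>n. U n"]
proof (rule SUP_least, clarify)
  fix K assume K: "compact K" "K \<subseteq> (\<Union>n. U n)"
  obtain S where S: "finite S" "K \<subseteq> (\<Union>n\<in>S. U n)"
    using compactE_image[OF K(1), of UNIV U] K(2) assms by metis
  obtain N where "S \<subseteq> {..<N}"
    using finite_nat_bounded[OF S(1)] by blast
  then have "K \<subseteq> (\<Union>n<N. U n)"
    using S(2) by blast
  then have "ennreal (l K) \<le> (\<Sum>n<N. inner_content l (U n))"
    by (rule content_le_sum_inner_content[OF K(1) assms])
  also have "\<dots> \<le> (\<Sum>n. inner_content l (U n))"
    by (rule sum_le_suminf) auto
  finally show "ennreal (l K) \<le> (\<Sum>n. inner_content l (U n))" .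
qed

lemma outer_content_UN_le:
  fixes A :: "nat \<Rightarrow> 'a set"
  shows "outer_content l (\<Union>n. A n) \<le> (\<Sum>n. outer_content l (A n))"
proof (rule ennreal_le_epsilon)
  fix e :: real assume e: "0 < e" and fin: "(\<Sum>n. outer_content l (A n)) < top"
  have "\<exists>U. open U \<and> A n \<subseteq> U \<and> inner_content l U \<le> outer_content l (A n) + ennreal (e * (1/2)^Suc n)" for n
  proof -
    have "outer_content l (A n) < outer_content l (A n) + ennreal (e * (1/2)^Suc n)"
      using e fin by (auto simp add: less_top dest!: ennreal_suminf_lessD)
    then have "(INF U\<in>{U. open U \<and> A n \<subseteq> U}. inner_content l U) < outer_content l (A n) + ennreal (e * (1/2)^Suc n)"
      by (simp only: outer_content_def)
    then show ?thesis
      unfolding INF_less_iff by (auto intro: less_imp_le)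
  qed
  then obtain U where U: "\<And>n. open (U n)" "\<And>n. A n \<subseteq> U n"
      "\<And>n. inner_content l (U n) \<le> outer_content l (A n) + ennreal (e * (1/2)^Suc n)"
    by metis
  have "outer_content l (\<Union>n. A n) \<le> outer_content l (\<Union>n. U n)"
    using U(2) by (intro outer_content_mono) blast
  also have "\<dots> = inner_content l (\<Union>n. U n)"
    using U(1) by (intro outer_content_open) auto
  also have "\<dots> \<le> (\<Sum>n. inner_content l (U n))"
    by (rule inner_content_UN_le[OF U(1)])
  also have "\<dots> \<le> (\<Sum>n. outer_content l (A n) + ennreal (e * (1/2)^Suc n))"
    by (intro suminf_le U(3)) auto
  also have "\<dots> = (\<Sum>n. outer_content l (A n)) + (\<Sum>n. ennreal e * ennreal ((1/2) ^ Suc n))"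
    using e by (subst suminf_add[symmetric])
      (auto simp del: ennreal_suminf_cmult simp add: ennreal_mult[symmetric])
  also have "\<dots> = (\<Sum>n. outer_content l (A n)) + e"
    unfolding ennreal_suminf_cmult
    by (subst suminf_ennreal_eq[OF zero_le_power power_half_series]) auto
  finally show "outer_content l (\<Union>n. A n) \<le> (\<Sum>n. outer_content l (A n)) + e" .
qed

lemma outer_content_empty: "outer_content l {} = 0"
  by (simp add: outer_content_open inner_content_def content_empty Collect_conv_if)

lemma outer_measure_space_outer_content: "outer_measure_space UNIV (outer_content l)"
  unfolding outer_measure_space_def positive_def increasing_def countably_subadditive_def
  by (auto simp: outer_content_empty outer_content_mono outer_content_UN_le)

text \<open>Exhaust \<open>U \<inter> V\<close> by a compact \<open>K\<close>, then the open set \<open>V - K\<close> by a compact \<open>L\<close>: the two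
  are disjoint, so their contents add up inside \<open>V\<close>.  This is the measurability of \<open>U\<close> in the sense of
  Caratheodory, tested on open sets.\<close>
lemma inner_content_split_le:
  assumes "open U" "open V"
  shows "inner_content l (U \<inter> V) + outer_content l (V - U) \<le> inner_content l V"
proof -
  have "ennreal (l K) + outer_content l (V - U) \<le> inner_content l V" if K: "compact K" "K \<subseteq> U \<inter> V" for K
  proof -
    have opn: "open (V - K)"
      using K assms by (simp add: compact_imp_closed open_Diff)
    have "ennreal (l K) + outer_content l (V - U) \<le> ennreal (l K) + outer_content l (V - K)"
      using K by (intro add_left_mono outer_content_mono) blast
    also have "\<dots> = (SUP L\<in>{L. compact L \<and> L \<subseteq> V - K}. ennreal (l K) + ennreal (l L))"
      unfolding outer_content_open[OF opn] inner_content_def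
      by (rule ennreal_SUP_add_right) (auto intro: exI[of _ "{}"])
    also have "\<dots> \<le> inner_content l V"
    proof (rule SUP_least, clarify)
      fix L assume L: "compact L" "L \<subseteq> V - K"
      have "ennreal (l K) + ennreal (l L) = ennreal (l (K \<union> L))"
      proof -
        have "K \<inter> L = {}"
          using L by blast
        then show ?thesis
          using additive[OF K(1) L(1)] nonneg[OF K(1)] nonneg[OF L(1)] by (simp add: ennreal_plus)
      qed
      also have "\<dots> \<le> inner_content l V"
        using K L by (intro content_le_inner_content compact_Un) auto
      finally show "ennreal (l K) + ennreal (l L) \<le> inner_content l V" .
    qed
    finally show ?thesis .
  qed
  then have "(SUP K\<in>{K. compact K \<and> K \<subseteq> U \<inter> V}. ennreal (l K) + outer_content l (V - U)) \<le> inner_content l V"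
    by (intro SUP_least) auto
  then show ?thesis
    unfolding inner_content_def[of l "U \<inter> V"]
    by (subst ennreal_SUP_add_left[symmetric]) (auto intro: exI[of _ "{}"])
qed

lemma open_in_lambda_system:
  assumes "open U"
  shows "U \<in> lambda_system UNIV UNIV (outer_content l)"
  unfolding lambda_system_def
proof (intro CollectI conjI ballI antisym)
  fix A :: "'a set"
  have "outer_content l A \<le> (\<Sum>n. outer_content l (binaryset (U \<inter> A) ((UNIV - U) \<inter> A) n))"
    using outer_content_UN_le[of "binaryset (U \<inter> A) ((UNIV - U) \<inter> A)"]
    by (simp add: UN_binaryset_eq) (metis Int_Un_distrib2 Un_Diff_cancel Un_UNIV_right inf_top_left)
  also have "\<dots> = outer_content l (U \<inter> A) + outer_content l ((UNIV - U) \<inter> A)"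
    by (intro suminf_binaryset_eq outer_content_empty)
  finally show "outer_content l A \<le> outer_content l (U \<inter> A) + outer_content l ((UNIV - U) \<inter> A)" .
  show "outer_content l (U \<inter> A) + outer_content l ((UNIV - U) \<inter> A) \<le> outer_content l A"
    unfolding outer_content_def[of l A]
  proof (rule INF_greatest, clarify)
    fix V assume V: "open V" "A \<subseteq> V"
    have "outer_content l (U \<inter> A) + outer_content l ((UNIV - U) \<inter> A)
        \<le> outer_content l (U \<inter> V) + outer_content l (V - U)"
      using V by (intro add_mono outer_content_mono) auto
    also have "\<dots> \<le> inner_content l V"
      using inner_content_split_le[OF assms V(1)] assms V(1) by (simp add: outer_content_open open_Int)
    finally show "outer_content l (U \<inter> A) + outer_content l ((UNIV - U) \<inter> A) \<le> inner_content l V" .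
  qed
qed auto

definition content_measure :: "'a measure" where
  "content_measure = measure_of UNIV (sets borel) (outer_content l)"

lemma sets_content_measure [simp, measurable_cong]: "sets content_measure = sets borel"
  unfolding content_measure_def by (metis sets.sigma_algebra_axioms sigma_algebra.sets_measure_of_eq space_borel)

lemma emeasure_content_measure:
  assumes "A \<in> sets borel"
  shows "emeasure content_measure A = outer_content l A"
proof -
  interpret U: sigma_algebra UNIV "UNIV :: 'a set set"
    by (simp add: sigma_algebra_Pow flip: Pow_UNIV)
  have ms: "measure_space UNIV (lambda_system UNIV UNIV (outer_content l)) (outer_content l)"
    by (rule U.caratheodory_lemma[OF outer_measure_space_outer_content])
  then interpret L: sigma_algebra UNIV "lambda_system UNIV UNIV (outer_content l)"
    by (simp add: measure_space_def)
  have "sets borel \<subseteq> lambda_system UNIV UNIV (outer_content l)"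
    unfolding sets_borel by (intro L.sigma_sets_subset) (auto intro: open_in_lambda_system)
  then have ms': "measure_space UNIV (sets borel) (outer_content l)"
    by (intro measure_down[OF ms]) (metis sets.sigma_algebra_axioms space_borel)
  show ?thesis
    unfolding content_measure_def
    by (rule emeasure_measure_of_sigma)
      (use ms' assms in \<open>auto simp: measure_space_def\<close>)
qed

end

section \<open>An invariant measure class on the group\<close>

lemma borel_right_translation:
  fixes A :: "'g::topological_group_add set"
  assumes "A \<in> sets borel"
  shows "(\<lambda>u. u + g) ` A \<in> sets borel"
proof -
  have "(\<lambda>x::'g. x + - g) \<in> borel_measurable borel"
    by (intro borel_measurable_continuous_onI continuous_on_add continuous_on_id continuous_on_const)
  from measurable_sets[OF this assms] show ?thesis
    by (simp add: image_right_translation_eq_vimage)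
qed

lemma content_measure_right_invariant:
  fixes l :: "'g::{topological_group_add, t2_space} set \<Rightarrow> real"
  assumes l: "content_on_compacts l" and inv: "\<And>K g. compact K \<Longrightarrow> l ((\<lambda>u. u + g) ` K) = l K"
    and A: "A \<in> sets borel"
  shows "emeasure (content_on_compacts.content_measure l) ((\<lambda>u. u + g) ` A) = emeasure (content_on_compacts.content_measure l) A"
proof -
  interpret content_on_compacts l by fact
  have inverse: "(\<lambda>u. u + - a) ` (\<lambda>u. u + a) ` B = B" for a :: 'g and B
    by (auto simp: image_image)
  have inner_le: "inner_content l U \<le> inner_content l ((\<lambda>u. u + a) ` U)" for U a
    unfolding inner_content_def[of l U]
  proof (rule SUP_least, clarify)
    fix K assume K: "compact K" "K \<subseteq> U"
    have "ennreal (l K) = ennreal (l ((\<lambda>u. u + a) ` K))"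
      using inv[OF K(1)] by simp
    also have "\<dots> \<le> inner_content l ((\<lambda>u. u + a) ` U)"
      using K by (intro content_le_inner_content compact_right_translation) auto
    finally show "ennreal (l K) \<le> inner_content l ((\<lambda>u. u + a) ` U)" .
  qed
  have inner: "inner_content l ((\<lambda>u. u + a) ` U) = inner_content l U" for U a
    using inner_le[of U a] inner_le[of "(\<lambda>u. u + a) ` U" "- a"] unfolding inverse by simp
  have outer_le: "outer_content l ((\<lambda>u. u + a) ` B) \<le> outer_content l B" for B a
    unfolding outer_content_def[of l B]
  proof (rule INF_greatest, clarify)
    fix U assume U: "open U" "B \<subseteq> U"
    have "outer_content l ((\<lambda>u. u + a) ` B) \<le> outer_content l ((\<lambda>u. u + a) ` U)"
      using U by (intro outer_content_mono) auto
    then show "outer_content l ((\<lambda>u. u + a) ` B) \<le> inner_content l U"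
      using U by (simp add: outer_content_open open_right_translation inner)
  qed
  have "outer_content l ((\<lambda>u. u + g) ` A) = outer_content l A"
    using outer_le[of g A] outer_le[of "- g" "(\<lambda>u. u + g) ` A"] unfolding inverse by simp
  moreover have "(\<lambda>u. u + g) ` A \<in> sets borel"
    using A by (rule borel_right_translation)
  ultimately show ?thesis
    using A by (simp add: emeasure_content_measure)
qed

text \<open>The content yields a right invariant measure that is finite on a neighbourhood of \<open>0\<close>.  By the
  Lindelof property countably many translates of this neighbourhood cover the group, so the measure
  is sigma-finite and can be reweighted by a positive density to a probability measure with the same
  null sets.  Only the null sets matter below, and the claim is phrased in terms of them.\<close>
lemma exists_right_quasi_invariant_prob:
  assumes "locally_compact_space
    (euclidean :: 'g::{topological_group_add, second_countable_topology, t2_space} topology)"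
  obtains p :: "'g::{topological_group_add, second_countable_topology, t2_space} measure" where "prob_space p" "sets p = sets borel"
    "\<And>P g. (AE h in p. P h) \<Longrightarrow> (AE h in p. P (h + g))"
proof -
  obtain V C :: "'g set" where VC: "compact C" "open V" "0 \<in> V" "V \<subseteq> C"
    using assms unfolding locally_compact_space_def by simp metis
  obtain l :: "'g set \<Rightarrow> real" where l: "l C = 1"
    "\<And>K. compact K \<Longrightarrow> 0 \<le> l K"
    "\<And>K L. compact K \<Longrightarrow> compact L \<Longrightarrow> K \<subseteq> L \<Longrightarrow> l K \<le> l L"
    "\<And>K L. compact K \<Longrightarrow> compact L \<Longrightarrow> l (K \<union> L) \<le> l K + l L"
    "\<And>K L. compact K \<Longrightarrow> compact L \<Longrightarrow> K \<inter> L = {} \<Longrightarrow> l (K \<union> L) = l K + l L"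
    "\<And>K g. compact K \<Longrightarrow> l ((\<lambda>u. u + g) ` K) = l K"
    using exists_right_invariant_content[OF VC] by blast
  interpret content_on_compacts l
    by unfold_locales (use l in auto)
  define m where "m = content_measure"
  have sets_m [simp, measurable_cong]: "sets m = sets borel" and space_m [simp]: "space m = UNIV"
    using sets_content_measure sets_eq_imp_space_eq[OF sets_content_measure] by (simp_all add: m_def)
  have inv: "emeasure m ((\<lambda>u. u + g) ` A) = emeasure m A" if "A \<in> sets borel" for A g
    unfolding m_def by (rule content_measure_right_invariant[OF content_on_compacts_axioms l(6) that])
  have open_translate: "open ((\<lambda>u. u + h) ` V)" for h
    by (rule open_right_translation[OF VC(2)])
  have fin: "emeasure m V < top"
  proof -
    have "emeasure m V = inner_content l V"
      using VC by (simp add: m_def emeasure_content_measure outer_content_open)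
    also have "\<dots> \<le> ennreal (l C)"
      unfolding inner_content_def using VC l(3) by (intro SUP_least) (auto intro!: ennreal_leI)
    finally show ?thesis
      by (simp add: l(1) order_le_less_trans)
  qed
  have "emeasure m UNIV \<ge> 1"
  proof -
    have "1 = ennreal (l C)"
      by (simp add: l(1))
    also have "\<dots> \<le> inner_content l UNIV"
      using VC by (intro content_le_inner_content) auto
    finally show ?thesis
      by (simp add: m_def emeasure_content_measure outer_content_open)
  qed
  then have nonzero: "emeasure m (space m) \<noteq> 0"
    by auto
  have "sigma_finite_measure m"
  proof
    obtain \<F> where \<F>: "\<F> \<subseteq> range (\<lambda>h. (\<lambda>u. u + h) ` V)" "countable \<F>"
        "\<Union>\<F> = \<Union>(range (\<lambda>h. (\<lambda>u. u + h) ` V))"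
      using Lindelof[of "range (\<lambda>h. (\<lambda>u. u + h) ` V)"] open_translate by blast
    have "x \<in> (\<lambda>u. u + x) ` V" for x
      using VC(3) by (intro image_eqI[of _ _ 0]) auto
    then have "\<Union>\<F> = space m"
      unfolding \<F>(3) by auto
    moreover have "A \<in> sets m \<and> emeasure m A \<noteq> \<infinity>" if "A \<in> \<F>" for A
      using that \<F>(1) inv[of V] VC(2) fin open_translate by auto
    ultimately show "\<exists>A. countable A \<and> A \<subseteq> sets m \<and> \<Union>A = space m \<and> (\<forall>a\<in>A. emeasure m a \<noteq> \<infinity>)"
      using \<F>(2) by (intro exI[of _ \<F>]) auto
  qed
  then obtain f where f: "f \<in> borel_measurable m" "integral\<^sup>N m f \<noteq> \<infinity>" "\<And>x. 0 < f x"
    using sigma_finite_measure.Ex_finite_integrable_function[of m] by auto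
  define c where "c = integral\<^sup>N m f"
  have c: "c \<noteq> 0" "c \<noteq> \<infinity>"
  proof
    assume "c = 0"
    then have "AE x in m. f x = 0"
      using f(1) by (simp add: c_def nn_integral_0_iff_AE)
    then have "AE x in m. False"
      by eventually_elim (use f(3) in \<open>auto simp: less_le\<close>)
    then show False
      using nonzero by (simp add: eventually_False ae_filter_eq_bot_iff)
  qed (use f(2) in \<open>simp add: c_def\<close>)
  define p where "p = density m (\<lambda>x. f x / c)"
  have sets_p: "sets p = sets borel"
    by (simp add: p_def)
  have AE_p: "(AE x in p. P x) \<longleftrightarrow> (AE x in m. P x)" for P
  proof -
    have "f x / c > 0" for x
      using f(3)[of x] c by (simp add: ennreal_zero_less_divide less_top)
    moreover have "(\<lambda>x. f x / c) \<in> borel_measurable m"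
      using f(1) by (intro borel_measurable_divide_ennreal) auto
    ultimately show ?thesis
      unfolding p_def by (simp add: AE_density)
  qed
  show ?thesis
  proof
    show "prob_space p"
    proof
      have "emeasure p (space p) = (\<integral>\<^sup>+ x. f x / c \<partial>m)"
        using f(1) by (simp add: p_def emeasure_density)
      also have "\<dots> = c / c"
        using f(1) by (simp add: nn_integral_divide c_def)
      also have "\<dots> = 1"
        using c by (simp add: less_top)
      finally show "emeasure p (space p) = 1" .
    qed
    show "sets p = sets borel"
      by (rule sets_p)
    fix P g assume "AE h in p. P h"
    then obtain N where N: "N \<in> sets borel" "emeasure m N = 0" "{h. \<not> P h} \<subseteq> N"
      unfolding AE_p by (auto elim!: AE_E)
    have "emeasure m ((\<lambda>u. u + - g) ` N) = 0"
      using inv[OF N(1), of "- g"] N(2) by (simp only:)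
    moreover have "(\<lambda>u. u + - g) ` N \<in> sets m"
      using borel_right_translation[OF N(1), of "- g"] unfolding sets_m .
    ultimately have "(\<lambda>u. u + - g) ` N \<in> null_sets m"
      by (simp add: null_sets_def)
    moreover have "{h. \<not> P (h + g)} \<subseteq> (\<lambda>u. u + - g) ` N"
      using N(3) unfolding image_right_translation_eq_vimage by auto
    ultimately show "AE h in p. P (h + g)"
      unfolding AE_p by (intro AE_I'[of "(\<lambda>u. u + - g) ` N"]) auto
  qed
qed

section \<open>Standard Borel spaces through distances to a dense sequence\<close>

text \<open>The metric is capped at \<open>1\<close> so that the distances to the points \<open>y i\<close>, which serve as
  coordinates on the space, are elements of \<open>L\<^sup>\<infinity>\<close>.\<close>
locale standard_borel_metric = Metric_space "space N" d
  for N :: "'a measure" and d :: "'a \<Rightarrow> 'a \<Rightarrow> real" +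
  fixes y :: "nat \<Rightarrow> 'a"
  assumes complete: mcomplete
    and dist_le_1: "d a b \<le> 1"
    and centre: "y i \<in> space N"
    and centres_dense: "a \<in> space N \<Longrightarrow> 0 < e \<Longrightarrow> \<exists>i. d (y i) a < e"
    and sets_eq: "sets N = sigma_sets (space N) {U. openin mtopology U}"

lemma standard_borel_imp_metric:
  assumes "standard_borel N" "space N \<noteq> {}"
  obtains d y where "standard_borel_metric N d y"
proof -
  obtain T where T: "completely_metrizable_space T" "second_countable T" "topspace T = space N"
      "sets N = sigma_sets (space N) {U. openin T U}"
    using assms(1) unfolding standard_borel_def by blast
  obtain S d where S: "Metric_space S d" "Metric_space.mcomplete S d" "T = Metric_space.mtopology S d"
    using T(1) unfolding completely_metrizable_space_def by blast
  interpret D: Metric_space S d by fact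
  have S_eq: "S = space N"
    using T(3) S(3) by simp
  define c where "c = D.capped_dist 1"
  interpret C: Metric_space S c
    unfolding c_def by (rule D.capped_dist)
  have topC: "C.mtopology = T"
    unfolding c_def S(3) by (rule D.mtopology_capped_metric)
  obtain A where A: "countable A" "A \<subseteq> topspace T" "T closure_of A = topspace T"
    using second_countable_imp_separable_space[OF T(2)] unfolding separable_space_def by blast
  have "A \<noteq> {}"
    using A(3) T(3) assms(2) by auto
  define y where "y = from_nat_into A"
  have y: "range y = A"
    unfolding y_def using A(1) \<open>A \<noteq> {}\<close> by simp
  have "standard_borel_metric N c y"
    unfolding standard_borel_metric_def standard_borel_metric_axioms_def S_eq[symmetric]
  proof (intro conjI allI impI)
    show "Metric_space S c" ..
    show "C.mcomplete"
      unfolding c_def using S(2) by (simp add: D.mcomplete_capped_metric)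
    show "c a b \<le> 1" for a b
      by (simp add: c_def D.capped_dist_def)
    show "y i \<in> S" for i
      using y A(2) T(3) S_eq by auto
    show "\<exists>i. c (y i) a < e" if a: "a \<in> S" and e: "0 < e" for a e
    proof -
      have "a \<in> C.mtopology closure_of A"
        using A(3) T(3) a S_eq unfolding topC by simp
      then obtain b where "b \<in> A" "b \<in> C.mball a e"
        using e unfolding C.metric_closure_of by blast
      then show ?thesis
        using y C.commute by (metis C.in_mball rangeE)
    qed
    show "sets N = sigma_sets S {U. openin C.mtopology U}"
      unfolding topC using T(4) S_eq by simp
  qed
  then show ?thesis
    using that by blast
qed

context standard_borel_metric
begin

lemma dist_measurable [measurable]:
  assumes "a \<in> space N"
  shows "d a \<in> borel_measurable N"
  unfolding borel_measurable_iff_less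
proof
  fix r
  have "{b \<in> space N. d a b < r} = mball a r"
    using assms by (auto simp: mball_def)
  then show "{b \<in> space N. d a b < r} \<in> sets N"
    by (simp add: sets_eq sigma_sets.Basic)
qed

lemma dist_in_Linfty: "a \<in> space N \<Longrightarrow> d a \<in> Linfty N"
proof -
  assume "a \<in> space N"
  moreover have "\<bar>d a b\<bar> \<le> 1" for b
    using dist_le_1[of a b] by simp
  ultimately show "d a \<in> Linfty N"
    by (auto simp: Linfty_def intro!: exI[of _ 1])
qed

text \<open>Every open set is a countable union of balls around the points \<open>y i\<close>.\<close>
lemma measurable_if_dist_measurable:
  assumes f: "\<And>w. w \<in> space L \<Longrightarrow> f w \<in> space N"
    and dist: "\<And>i. (\<lambda>w. d (y i) (f w)) \<in> borel_measurable L"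
  shows "f \<in> measurable L N"
proof (rule measurable_sigma_sets[OF sets_eq])
  show "{U. openin mtopology U} \<subseteq> Pow (space N)"
    using openin_mtopology by auto
  show "f \<in> space L \<rightarrow> space N"
    using f by auto
  fix U assume "U \<in> {U. openin mtopology U}"
  then have U: "U \<subseteq> space N" "\<And>a. a \<in> U \<Longrightarrow> \<exists>r>0. mball a r \<subseteq> U"
    by (auto simp: openin_mtopology)
  define I where "I = {(i, n). mball (y i) (1 / real (Suc n)) \<subseteq> U}"
  have "f -` U \<inter> space L = (\<Union>(i, n)\<in>I. {w \<in> space L. d (y i) (f w) < 1 / real (Suc n)})"
  proof (intro equalityI subsetI)
    fix w assume w: "w \<in> f -` U \<inter> space L"
    then obtain r where r: "0 < r" "mball (f w) r \<subseteq> U"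
      using U(2) by blast
    obtain n where n: "1 / real (Suc n) < r / 2"
      using r(1) nat_approx_posE[of "r / 2"] by auto
    obtain i where i: "d (y i) (f w) < 1 / real (Suc n)"
      using centres_dense[of "f w" "1 / real (Suc n)"] f[of w] w by auto
    have "mball (y i) (1 / real (Suc n)) \<subseteq> mball (f w) r"
    proof
      fix b assume b: "b \<in> mball (y i) (1 / real (Suc n))"
      then have "d (f w) b \<le> d (f w) (y i) + d (y i) b"
        using f[of w] w centre by (intro triangle) auto
      then show "b \<in> mball (f w) r"
        using b i n f[of w] w commute[of "f w" "y i"] by auto
    qed
    then have "(i, n) \<in> I"
      using r(2) by (auto simp: I_def)
    then show "w \<in> (\<Union>(i, n)\<in>I. {w \<in> space L. d (y i) (f w) < 1 / real (Suc n)})"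
      using i w by auto
  next
    fix w assume "w \<in> (\<Union>(i, n)\<in>I. {w \<in> space L. d (y i) (f w) < 1 / real (Suc n)})"
    then obtain i n where "mball (y i) (1 / real (Suc n)) \<subseteq> U" "w \<in> space L" "d (y i) (f w) < 1 / real (Suc n)"
      by (auto simp: I_def)
    then show "w \<in> f -` U \<inter> space L"
      using f[of w] centre[of i] by auto
  qed
  also have "\<dots> \<in> sets L"
    using dist by (intro sets.countable_UN') (auto intro!: borel_measurable_less countableI_type)
  finally show "f -` U \<inter> space L \<in> sets L" .
qed

lemma eq_if_dist_eq:
  assumes "a \<in> space N" "b \<in> space N" "\<And>i. d (y i) a = d (y i) b"
  shows "a = b"
proof (rule ccontr)
  assume "a \<noteq> b"
  then have "0 < d a b / 2"
    using assms(1,2) mdist_pos_less by auto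
  then obtain i where "d (y i) a < d a b / 2"
    using centres_dense[OF assms(1)] by blast
  moreover have "d a b \<le> d a (y i) + d (y i) b"
    using assms(1,2) centre by (intro triangle)
  ultimately show False
    using assms(3)[of i] commute[of a "y i"] by simp
qed

text \<open>The inequalities say that \<open>t\<close> behaves like the distances from one further point, and \<open>small\<close> that
  the sequence \<open>y\<close> comes arbitrarily close to this point.  They force the points \<open>y i\<close> with small
  \<open>t i\<close> to form a Cauchy sequence, whose limit is the point sought.  Countably many inequalities thus
  characterise the image of the space under its coordinates.\<close>
lemma point_with_prescribed_dists:
  assumes upper: "\<And>i j. d (y i) (y j) \<le> t i + t j"
    and lower: "\<And>i j. t j \<le> d (y i) (y j) + t i"
    and small: "\<And>n. \<exists>i. t i < 1 / real (Suc n)"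
  obtains a where "a \<in> space N" "\<And>j. d (y j) a = t j"
proof -
  obtain k where k: "\<And>n. t (k n) < 1 / real (Suc n)"
    using small by metis
  have t_nonneg: "0 \<le> t i" for i
    using order_trans[OF nonneg upper[of i i]] by simp
  have t_tendsto: "(\<lambda>n. t (k n)) \<longlonglongrightarrow> 0"
    using k t_nonneg by (intro tendsto_sandwich[OF _ _ tendsto_const LIMSEQ_inverse_real_of_nat])
      (auto simp: inverse_eq_divide intro!: always_eventually less_imp_le)
  have "MCauchy (\<lambda>n. y (k n))"
    unfolding MCauchy_def
  proof (intro conjI allI impI)
    show "range (\<lambda>n. y (k n)) \<subseteq> space N"
      using centre by auto
    fix e :: real assume "0 < e"
    then have "eventually (\<lambda>n. t (k n) < e / 2) sequentially"
      using t_tendsto by (intro order_tendstoD) auto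
    then obtain m where m: "\<And>n. m \<le> n \<Longrightarrow> t (k n) < e / 2"
      unfolding eventually_sequentially by blast
    have "d (y (k n)) (y (k n')) < e" if "m \<le> n" "m \<le> n'" for n n'
      using upper[of "k n" "k n'"] m[OF that(1)] m[OF that(2)] by simp
    then show "\<exists>m. \<forall>n n'. m \<le> n \<longrightarrow> m \<le> n' \<longrightarrow> d (y (k n)) (y (k n')) < e"
      by blast
  qed
  then obtain a where a: "limitin mtopology (\<lambda>n. y (k n)) a sequentially"
    using complete unfolding mcomplete_def by blast
  then have a_in: "a \<in> space N" and dist0: "(\<lambda>n. d (y (k n)) a) \<longlonglongrightarrow> 0"
    by (auto simp: limitin_metric_dist_null)
  have "d (y j) a = t j" for j
  proof -
    have "\<bar>d (y j) a - t j\<bar> \<le> d (y (k n)) a + t (k n)" for n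
    proof -
      have "d (y j) a \<le> d (y j) (y (k n)) + d (y (k n)) a"
        "d (y j) (y (k n)) \<le> d (y j) a + d a (y (k n))"
        using centre a_in by (auto intro!: triangle)
      then show ?thesis
        using upper[of j "k n"] lower[of j "k n"] commute[of a "y (k n)"] commute[of "y j" "y (k n)"]
        by simp
    qed
    moreover have "(\<lambda>n. d (y (k n)) a + t (k n)) \<longlonglongrightarrow> 0"
      using tendsto_add[OF dist0 t_tendsto] by simp
    ultimately have "\<bar>d (y j) a - t j\<bar> \<le> 0"
      by (intro tendsto_lowerbound[of _ 0 sequentially]) (auto intro: always_eventually)
    then show ?thesis
      by simp
  qed
  then show ?thesis
    using that a_in by blast
qed

end

text \<open>The diagonal is measurable because countably many coordinates separate points.\<close>
lemma standard_borel_eq_measurable: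
  assumes "standard_borel N" and f: "f \<in> measurable L N" and g: "g \<in> measurable L N"
  shows "{w \<in> space L. f w = g w} \<in> sets L"
proof (cases "space N = {}")
  case True
  then have "space L = {}"
    using measurable_space[OF f] by blast
  then show ?thesis
    by simp
next
  case False
  then obtain d y where "standard_borel_metric N d y"
    using standard_borel_imp_metric[OF assms(1)] by blast
  then interpret standard_borel_metric N d y .
  have "{w \<in> space L. f w = g w} = {w \<in> space L. \<forall>i. d (y i) (f w) = d (y i) (g w)}"
    using eq_if_dist_eq measurable_space[OF f] measurable_space[OF g] by auto
  also have "\<dots> \<in> sets L"
  proof -
    have "(\<lambda>w. d (y i) (f w)) \<in> borel_measurable L" "(\<lambda>w. d (y i) (g w)) \<in> borel_measurable L" for i
      using measurable_compose[OF f dist_measurable[OF centre]]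
        measurable_compose[OF g dist_measurable[OF centre]] by auto
    then show ?thesis
      by measurable
  qed
  finally show ?thesis .
qed

section \<open>Almost everywhere statements along orbits\<close>

context G_space
begin

lemma act_in_space [simp]: "x \<in> space M \<Longrightarrow> act g x \<in> space M"
  using measurable_space[OF act_measurable, of "(g, x)"] by (simp add: space_pair_measure)

lemma measurable_act:
  assumes f: "f \<in> borel_measurable L" and k: "k \<in> measurable L M"
  shows "(\<lambda>w. act (f w) (k w)) \<in> measurable L M"
  using measurable_compose[OF measurable_Pair[OF f k] act_measurable] by simp

lemma measurable_act_fixed: "act g \<in> measurable M M"
  using measurable_act[of "\<lambda>_. g" M "\<lambda>x. x"] by simp

lemma act_uminus_act: "x \<in> space M \<Longrightarrow> act (- g) (act g x) = x"
  using act_add[of x "- g" g] act_zero by simp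

lemma AE_act:
  assumes "AE x in M. P x"
  shows "AE x in M. P (act g x)"
proof -
  obtain N where N: "{x \<in> space M. \<not> P x} \<subseteq> N" "N \<in> null_sets M"
    using assms unfolding eventually_ae_filter by auto
  show ?thesis
    by (rule AE_I'[OF act_quasi_invariant[OF N(2), of g]])
      (use N(1) in \<open>auto simp: subset_iff\<close>)
qed

text \<open>Quasi-invariance gives the statement for each \<open>h\<close> at almost every \<open>x\<close>; Fubini exchanges the
  quantifiers after the exceptional set has been enlarged to a measurable null set.\<close>
lemma AE_AE_act:
  fixes p :: "'g measure"
  assumes p: "prob_space p" "sets p = sets borel" and "AE x in M. P x"
  shows "AE x in M. AE h in p. P (act h x)"
proof -
  obtain N where N: "{x \<in> space M. \<not> P x} \<subseteq> N" "N \<in> null_sets M"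
    using assms(3) unfolding eventually_ae_filter by auto
  interpret p: prob_space p by fact
  interpret pM: pair_sigma_finite p M ..
  have [measurable_cong]: "sets p = sets borel" by fact
  have "(\<lambda>w. act (fst w) (snd w)) \<in> measurable (p \<Otimes>\<^sub>M M) M"
    by (rule measurable_act) auto
  moreover have "N \<in> sets M"
    using N(2) by auto
  ultimately have "{w \<in> space (p \<Otimes>\<^sub>M M). act (fst w) (snd w) \<notin> N} \<in> sets (p \<Otimes>\<^sub>M M)"
    by measurable
  moreover have "AE x in M. act h x \<notin> N" for h
    using AE_act[OF AE_not_in[OF N(2)]] .
  ultimately have "AE x in M. AE h in p. act h x \<notin> N"
    by (subst pM.AE_commute[symmetric]) auto
  then show ?thesis
    using AE_space
  proof eventually_elim
    case (elim x)
    have "P (act h x)" if "act h x \<notin> N" for h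
      using that N(1) act_in_space[OF elim(2), of h] by blast
    then show ?case
      using elim(1) by (auto elim!: eventually_mono)
  qed
qed

end

lemma G_map_measurable: "G_map actX X actY Y \<pi> \<Longrightarrow> \<pi> \<in> measurable X Y"
  by (simp add: G_map_def)

lemma G_map_distr: "G_map actX X actY Y \<pi> \<Longrightarrow> distr X Y \<pi> = Y"
  by (simp add: G_map_def)

lemma Linfty_comp_G_map:
  assumes \<pi>: "G_map actX X actY Y \<pi>" and F: "F \<in> Linfty Y"
  shows "(\<lambda>x. F (\<pi> x)) \<in> Linfty X"
proof -
  have m: "\<pi> \<in> measurable X Y"
    using \<pi> by (rule G_map_measurable)
  obtain C where "AE z in Y. \<bar>F z\<bar> \<le> C"
    using F by (auto simp: Linfty_def)
  then have "AE z in distr X Y \<pi>. \<bar>F z\<bar> \<le> C"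
    unfolding G_map_distr[OF \<pi>] .
  then have "AE x in X. \<bar>F (\<pi> x)\<bar> \<le> C"
    by (rule AE_distrD[OF m])
  then show ?thesis
    using F measurable_compose[OF m] by (auto simp: Linfty_def)
qed

text \<open>The exceptional null set of \<open>G_map\<close> depends on \<open>h\<close>; measurability of the diagonal of \<open>Y\<close> makes
  Fubini applicable.\<close>
lemma AE_AE_G_map_equivariant:
  fixes actX :: "'g::{topological_group_add, second_countable_topology, t2_space} \<Rightarrow> 'x \<Rightarrow> 'x"
  assumes X: "G_space actX X" and Y: "G_space actY Y" and p: "prob_space p" "sets p = sets borel"
    and \<pi>: "G_map actX X actY Y \<pi>"
  shows "AE x in X. AE h in p. \<pi> (actX h x) = actY h (\<pi> x)"
proof -
  interpret X: G_space actX X by fact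
  interpret Y: G_space actY Y by fact
  interpret p: prob_space p by fact
  interpret pX: pair_sigma_finite p X ..
  have [measurable_cong]: "sets p = sets borel" by fact
  have m: "\<pi> \<in> measurable X Y"
    using \<pi> by (rule G_map_measurable)
  have "(\<lambda>w. \<pi> (actX (fst w) (snd w))) \<in> measurable (p \<Otimes>\<^sub>M X) Y"
    by (intro measurable_compose[OF _ m] X.measurable_act) auto
  moreover have "(\<lambda>w. actY (fst w) (\<pi> (snd w))) \<in> measurable (p \<Otimes>\<^sub>M X) Y"
    by (intro Y.measurable_act measurable_compose[OF measurable_snd m]) auto
  ultimately have "{w \<in> space (p \<Otimes>\<^sub>M X). \<pi> (actX (fst w) (snd w)) = actY (fst w) (\<pi> (snd w))} \<in> sets (p \<Otimes>\<^sub>M X)"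
    by (rule standard_borel_eq_measurable[OF Y.standard_borel])
  then have "(AE h in p. AE x in X. \<pi> (actX h x) = actY h (\<pi> x)) \<longleftrightarrow>
      (AE x in X. AE h in p. \<pi> (actX h x) = actY h (\<pi> x))"
    by (rule pX.AE_commute)
  then show ?thesis
    using \<pi> by (simp add: G_map_def)
qed

section \<open>Fields of closed subgroups\<close>

lemma hitting_set_measurable:
  assumes "open U"
  shows "{H \<in> closed_subgroups. H \<inter> U \<noteq> {}} \<in> sets (chabauty_borel :: 'g::topological_group_add set measure)"
proof -
  have "openin (topology_generated_by
        ({{H. H \<inter> K = {}} |K. compact K} \<union> {{H. H \<inter> U \<noteq> {}} |U. open U})) {H::'g set. H \<inter> U \<noteq> {}}"
    using assms by (intro topology_generated_by_Basis) auto
  then have "openin chabauty_topology ({H::'g set. H \<inter> U \<noteq> {}} \<inter> closed_subgroups)"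
    unfolding chabauty_topology_def openin_subtopology by blast
  moreover have "{W. openin chabauty_topology W} \<subseteq> Pow (closed_subgroups :: 'g set set)"
    using openin_subset[of "chabauty_topology :: 'g set topology"] by auto
  ultimately show ?thesis
    unfolding chabauty_borel_def
    by (auto simp: Collect_conj_eq Int_commute intro: sigma_sets.Basic)
qed

lemma space_chabauty_borel [simp]: "space chabauty_borel = closed_subgroups"
  unfolding chabauty_borel_def
  by (rule space_measure_of) (use openin_subset[of chabauty_topology] in auto)

lemma conj_subgroup_subset_iff_basis:
  fixes H K :: "'g::topological_group_add set"
  assumes "topological_basis B" "closed K"
  shows "conj_subgroup g H \<subseteq> K \<longleftrightarrow> (\<forall>U\<in>B. conj_subgroup g H \<inter> U \<noteq> {} \<longrightarrow> K \<inter> U \<noteq> {})"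
proof
  assume hit: "\<forall>U\<in>B. conj_subgroup g H \<inter> U \<noteq> {} \<longrightarrow> K \<inter> U \<noteq> {}"
  show "conj_subgroup g H \<subseteq> K"
  proof
    fix a assume a: "a \<in> conj_subgroup g H"
    show "a \<in> K"
    proof (rule ccontr)
      assume "a \<notin> K"
      then obtain U where "U \<in> B" "a \<in> U" "U \<subseteq> - K"
        using topological_basisE[OF assms(1), of "- K" a] assms(2) by (auto simp: open_Compl)
      then show False
        using hit a by blast
    qed
  qed
qed blast

text \<open>Conjugation is jointly continuous, so \<open>h + g - h \<in> U\<close> holds exactly if it holds on a
  product of two basic open sets around \<open>h\<close> and \<open>g\<close>.  The set in question is therefore a countable
  union of measurable rectangles.\<close>
lemma conj_hitting_measurable:
  fixes \<phi> :: "'x \<Rightarrow> 'g::{topological_group_add, second_countable_topology} set"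
  assumes \<phi>: "\<phi> \<in> measurable X chabauty_borel" and U: "open U"
  shows "{w \<in> space (borel \<Otimes>\<^sub>M X). conj_subgroup (fst w) (\<phi> (snd w)) \<inter> U \<noteq> {}} \<in> sets (borel \<Otimes>\<^sub>M X)"
proof -
  obtain B :: "'g set set" where B: "countable B" "topological_basis B"
    using ex_countable_basis by blast
  define I where "I = {(V, W). V \<in> B \<and> W \<in> B \<and> (\<forall>h\<in>V. \<forall>g\<in>W. h + g - h \<in> U)}"
  have "continuous_on UNIV (\<lambda>w::'g \<times> 'g. fst w + snd w + - fst w)"
    unfolding continuous_on_def
    by (intro ballI tendsto_add tendsto_minus tendsto_fst tendsto_snd tendsto_ident_at)
  then have opn: "open ((\<lambda>w::'g \<times> 'g. fst w + snd w + - fst w) -` U)"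
    using U by (rule open_vimage[rotated])
  have I: "\<exists>V W. (V, W) \<in> I \<and> h \<in> V \<and> g \<in> W" if "h + g - h \<in> U" for h g
  proof -
    have "(h, g) \<in> (\<lambda>w. fst w + snd w + - fst w) -` U"
      using that by simp
    then obtain V W where VW: "open V" "open W" "(h, g) \<in> V \<times> W"
        "V \<times> W \<subseteq> (\<lambda>w. fst w + snd w + - fst w) -` U"
      using open_prod_elim[OF opn] by blast
    obtain V' where "V' \<in> B" "h \<in> V'" "V' \<subseteq> V"
      using topological_basisE[OF B(2) VW(1)] VW(3) by blast
    moreover obtain W' where "W' \<in> B" "g \<in> W'" "W' \<subseteq> W"
      using topological_basisE[OF B(2) VW(2)] VW(3) by blast
    moreover have "h' + g' - h' \<in> U" if "h' \<in> V" "g' \<in> W" for h' g'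
      using subsetD[OF VW(4), of "(h', g')"] that by simp
    ultimately have "(V', W') \<in> I" "h \<in> V'" "g \<in> W'"
      by (auto simp: I_def)
    then show ?thesis
      by blast
  qed
  have "{w \<in> space (borel \<Otimes>\<^sub>M X). conj_subgroup (fst w) (\<phi> (snd w)) \<inter> U \<noteq> {}}
      = (\<Union>(V, W)\<in>I. V \<times> {x \<in> space X. \<phi> x \<inter> W \<noteq> {}})"
    (is "?L = ?R")
  proof (intro equalityI subsetI)
    fix w assume "w \<in> ?L"
    then obtain g where g: "g \<in> \<phi> (snd w)" "fst w + g - fst w \<in> U" "snd w \<in> space X"
      by (auto simp: conj_subgroup_def space_pair_measure)
    obtain V W where "(V, W) \<in> I" "fst w \<in> V" "g \<in> W"
      using I[OF g(2)] by blast
    then show "w \<in> ?R"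
      using g by (intro UN_I[of "(V, W)"]) (auto simp: mem_Times_iff)
  next
    fix w assume "w \<in> ?R"
    then obtain V W g where "(V, W) \<in> I" "fst w \<in> V" "snd w \<in> space X" "g \<in> \<phi> (snd w)" "g \<in> W"
      by auto
    then show "w \<in> ?L"
      by (auto simp: conj_subgroup_def space_pair_measure I_def mem_Times_iff)
  qed
  also have "\<dots> \<in> sets (borel \<Otimes>\<^sub>M X)"
  proof (intro sets.countable_UN'')
    show "countable I"
      by (rule countable_subset[of _ "B \<times> B"]) (use B(1) in \<open>auto simp: I_def\<close>)
    fix i assume "i \<in> I"
    then obtain V W where i: "i = (V, W)" "open V" "open W"
      using topological_basis_open[OF B(2)] by (auto simp: I_def)
    have "{x \<in> space X. \<phi> x \<inter> W \<noteq> {}} = \<phi> -` {H \<in> closed_subgroups. H \<inter> W \<noteq> {}} \<inter> space X"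
      using measurable_space[OF \<phi>] by auto
    also have "\<dots> \<in> sets X"
      by (rule measurable_sets[OF \<phi> hitting_set_measurable[OF i(3)]])
    finally show "(case i of (V, W) \<Rightarrow> V \<times> {x \<in> space X. \<phi> x \<inter> W \<noteq> {}}) \<in> sets (borel \<Otimes>\<^sub>M X)"
      using i by (auto intro!: pair_measureI)
  qed
  finally show ?thesis .
qed

text \<open>Inclusion in a closed subgroup can be tested on a countable basis of open sets, so it defines a
  measurable set of pairs \<open>(h, x)\<close> and Fubini applies.\<close>
lemma AE_AE_conj_subgroup_subset:
  fixes \<phi> :: "'x \<Rightarrow> 'g::{topological_group_add, second_countable_topology, t2_space} set"
  assumes X: "G_space actX X" and p: "prob_space p" "sets p = sets borel"
    and \<phi>: "\<phi> \<in> measurable X chabauty_borel"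
    and equi: "\<forall>g. AE x in X. \<phi> (actX g x) = conj_subgroup g (\<phi> x)"
  shows "AE x in X. AE h in p. conj_subgroup h (\<phi> x) \<subseteq> \<phi> (actX h x)"
proof -
  interpret X: G_space actX X by fact
  interpret p: prob_space p by fact
  interpret pX: pair_sigma_finite p X ..
  have [measurable_cong]: "sets p = sets borel" by fact
  obtain B :: "'g set set" where B: "countable B" "topological_basis B"
    using ex_countable_basis by blast
  have closed_\<phi>: "closed (\<phi> x)" if "x \<in> space X" for x
    using measurable_space[OF \<phi> that] by (simp add: closed_subgroups_def)
  have sets_pX: "sets (p \<Otimes>\<^sub>M X) = sets (borel \<Otimes>\<^sub>M X)"
    by (intro sets_pair_measure_cong p refl)
  have act: "(\<lambda>w. actX (fst w) (snd w)) \<in> measurable (p \<Otimes>\<^sub>M X) X"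
    by (rule X.measurable_act) auto
  have "{w \<in> space (p \<Otimes>\<^sub>M X). conj_subgroup (fst w) (\<phi> (snd w)) \<subseteq> \<phi> (actX (fst w) (snd w))}
     = {w \<in> space (p \<Otimes>\<^sub>M X). \<forall>U\<in>B. conj_subgroup (fst w) (\<phi> (snd w)) \<inter> U \<noteq> {}
          \<longrightarrow> \<phi> (actX (fst w) (snd w)) \<inter> U \<noteq> {}}"
    using closed_\<phi>
    by (intro Collect_cong conj_cong refl conj_subgroup_subset_iff_basis[OF B(2)])
      (auto simp: space_pair_measure)
  also have "\<dots> \<in> sets (p \<Otimes>\<^sub>M X)"
  proof (rule sets.sets_Collect_countable_All'[OF _ B(1)], rule sets.sets_Collect_imp)
    fix U assume "U \<in> B"
    then have U: "open U"
      using topological_basis_open[OF B(2)] by blast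
    show "{w \<in> space (p \<Otimes>\<^sub>M X). conj_subgroup (fst w) (\<phi> (snd w)) \<inter> U \<noteq> {}} \<in> sets (p \<Otimes>\<^sub>M X)"
      using conj_hitting_measurable[OF \<phi> U] sets_eq_imp_space_eq[OF sets_pX] sets_pX by simp
    have m: "(\<lambda>w. \<phi> (actX (fst w) (snd w))) \<in> measurable (p \<Otimes>\<^sub>M X) chabauty_borel"
      by (rule measurable_compose[OF act \<phi>])
    have "{w \<in> space (p \<Otimes>\<^sub>M X). \<phi> (actX (fst w) (snd w)) \<inter> U \<noteq> {}}
        = (\<lambda>w. \<phi> (actX (fst w) (snd w))) -` {H \<in> closed_subgroups. H \<inter> U \<noteq> {}} \<inter> space (p \<Otimes>\<^sub>M X)"
      using measurable_space[OF m] by auto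
    also have "\<dots> \<in> sets (p \<Otimes>\<^sub>M X)"
      by (rule measurable_sets[OF m hitting_set_measurable[OF U]])
    finally show "{w \<in> space (p \<Otimes>\<^sub>M X). \<phi> (actX (fst w) (snd w)) \<inter> U \<noteq> {}} \<in> sets (p \<Otimes>\<^sub>M X)" .
  qed
  finally have "(AE h in p. AE x in X. conj_subgroup h (\<phi> x) \<subseteq> \<phi> (actX h x)) \<longleftrightarrow>
      (AE x in X. AE h in p. conj_subgroup h (\<phi> x) \<subseteq> \<phi> (actX h x))"
    by (rule pX.AE_commute)
  moreover have "AE x in X. conj_subgroup h (\<phi> x) \<subseteq> \<phi> (actX h x)" for h
    using equi[rule_format, of h] by eventually_elim simp
  ultimately show ?thesis
    by simp
qed

section \<open>Fixed points and the invariant algebra\<close>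

text \<open>The null sets in the hypotheses are avoided by a generic \<open>h\<close>: for a fixed \<open>x\<close> almost every
  \<open>h\<close> is good, and by right quasi-invariance so is \<open>h + g\<close>, for every single \<open>g \<in> \<phi> x\<close>.\<close>
lemma AE_subset_stab_if_invariant:
  fixes actX :: "'g::{topological_group_add, second_countable_topology, t2_space} \<Rightarrow> 'x \<Rightarrow> 'x"
  assumes lc: "locally_compact_space (euclidean :: 'g topology)"
    and X: "G_space actX X" and Y: "G_space actY Y" and \<pi>: "G_map actX X actY Y \<pi>"
    and \<phi>: "\<phi> \<in> measurable X chabauty_borel"
    and equi: "\<forall>g. AE x in X. \<phi> (actX g x) = conj_subgroup g (\<phi> x)"
    and inv: "\<And>F. F \<in> Linfty Y \<Longrightarrow> (\<lambda>x. F (\<pi> x)) \<in> invariant_algebra actX X \<phi>"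
  shows "AE x in X. \<phi> x \<subseteq> stab actY (\<pi> x)"
proof -
  interpret X: G_space actX X by fact
  interpret Y: G_space actY Y by fact
  obtain p :: "'g measure" where p: "prob_space p" "sets p = sets borel"
      and shift: "\<And>P g. (AE h in p. P h) \<Longrightarrow> (AE h in p. P (h + g))"
    using exists_right_quasi_invariant_prob[OF lc] by metis
  interpret p: prob_space p by fact
  have m: "\<pi> \<in> measurable X Y"
    using \<pi> by (rule G_map_measurable)
  obtain d y where "standard_borel_metric Y d y"
    using standard_borel_imp_metric[OF Y.standard_borel Y.not_empty] by blast
  then interpret D: standard_borel_metric Y d y .
  have "\<forall>i. \<exists>f'. (AE x in X. d (y i) (\<pi> x) = f' x) \<and> phi_invariant actX X \<phi> f'"
    using inv[OF D.dist_in_Linfty[OF D.centre]] unfolding invariant_algebra_def by blast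
  from choice[OF this] obtain f' where f': "\<And>i. AE x in X. d (y i) (\<pi> x) = f' i x"
      "\<And>i. AE x in X. \<forall>g\<in>\<phi> x. f' i (actX g x) = f' i x"
    unfolding phi_invariant_def by blast
  \<comment> \<open>Strict invariance along all of \<open>\<phi> x\<close>, for all coordinates at once, is a single null-set condition.\<close>
  define E where "E x \<longleftrightarrow> (\<forall>i. d (y i) (\<pi> x) = f' i x) \<and> (\<forall>i. \<forall>g\<in>\<phi> x. f' i (actX g x) = f' i x)" for x
  have "AE x in X. E x"
    unfolding E_def using f' by (simp add: AE_all_countable)
  then have "AE x in X. AE h in p. E (actX h x)"
    by (rule X.AE_AE_act[OF p])
  moreover have "AE x in X. AE h in p. conj_subgroup h (\<phi> x) \<subseteq> \<phi> (actX h x)"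
    by (rule AE_AE_conj_subgroup_subset[OF X p \<phi> equi])
  moreover have "AE x in X. AE h in p. \<pi> (actX h x) = actY h (\<pi> x)"
    by (rule AE_AE_G_map_equivariant[OF X Y p \<pi>])
  ultimately show ?thesis
    using AE_space
  proof eventually_elim
    case (elim x)
    have \<pi>x: "\<pi> x \<in> space Y"
      using elim(4) m by (rule measurable_space[rotated])
    show ?case
    proof
      fix g assume g: "g \<in> \<phi> x"
      have "AE h in p. E (actX h x) \<and> conj_subgroup h (\<phi> x) \<subseteq> \<phi> (actX h x)
          \<and> \<pi> (actX h x) = actY h (\<pi> x)"
        using elim(1-3) by eventually_elim simp
      moreover from shift[OF this, of g] have "AE h in p. E (actX (h + g) x)
          \<and> \<pi> (actX (h + g) x) = actY (h + g) (\<pi> x)"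
        by eventually_elim simp
      ultimately have "AE h in p. E (actX h x) \<and> conj_subgroup h (\<phi> x) \<subseteq> \<phi> (actX h x)
          \<and> \<pi> (actX h x) = actY h (\<pi> x) \<and> E (actX (h + g) x)
          \<and> \<pi> (actX (h + g) x) = actY (h + g) (\<pi> x)"
        by eventually_elim simp
      then obtain h where h: "E (actX h x)" "conj_subgroup h (\<phi> x) \<subseteq> \<phi> (actX h x)"
          "\<pi> (actX h x) = actY h (\<pi> x)" "E (actX (h + g) x)"
          "\<pi> (actX (h + g) x) = actY (h + g) (\<pi> x)"
        using eventually_happens'[OF p.ae_filter_bot] by blast
      \<comment> \<open>An element of \<open>\<phi> (actX h x)\<close> carries \<open>actX h x\<close> to \<open>actX (h + g) x\<close>.\<close>
      have "h + g - h \<in> \<phi> (actX h x)"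
        using h(2) g by (auto simp: conj_subgroup_def)
      moreover have "actX (h + g - h) (actX h x) = actX (h + g) x"
        using X.act_add[OF elim(4), of "h + g - h" h] by simp
      ultimately have "f' i (actX (h + g) x) = f' i (actX h x)" for i
        using h(1) unfolding E_def by metis
      then have "d (y i) (\<pi> (actX (h + g) x)) = d (y i) (\<pi> (actX h x))" for i
        using h(1,4) unfolding E_def by simp
      then have "actY (h + g) (\<pi> x) = actY h (\<pi> x)"
        using D.eq_if_dist_eq[of "actY (h + g) (\<pi> x)" "actY h (\<pi> x)"] h(3,5) \<pi>x by simp
      then have "actY h (actY g (\<pi> x)) = actY h (\<pi> x)"
        using Y.act_add[OF \<pi>x] by simp
      then have "actY g (\<pi> x) = \<pi> x"
        using \<pi>x Y.act_uminus_act[of "\<pi> x" h] Y.act_uminus_act[of "actY g (\<pi> x)" h] by simp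
      then show "g \<in> stab actY (\<pi> x)"
        by (simp add: stab_def)
    qed
  qed
qed

text \<open>The function \<open>F \<circ> \<pi>\<close> itself need not be strictly invariant, because \<open>\<pi>\<close> is equivariant only almost
  everywhere.  Averaging over the group repairs this.  At almost every \<open>x\<close> the integrand is almost everywhere
  equal to the constant \<open>F (\<pi> x)\<close>.  For \<open>g \<in> \<phi> x\<close> the same holds at \<open>actX g x\<close>: right translation by \<open>g\<close>
  preserves the null sets of the group, and \<open>actY g\<close> fixes \<open>\<pi> x\<close>.\<close>
lemma invariant_if_AE_subset_stab:
  fixes actX :: "'g::{topological_group_add, second_countable_topology, t2_space} \<Rightarrow> 'x \<Rightarrow> 'x"
  assumes lc: "locally_compact_space (euclidean :: 'g topology)"
    and X: "G_space actX X" and Y: "G_space actY Y" and \<pi>: "G_map actX X actY Y \<pi>"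
    and sub: "AE x in X. \<phi> x \<subseteq> stab actY (\<pi> x)" and F: "F \<in> Linfty Y"
  shows "(\<lambda>x. F (\<pi> x)) \<in> invariant_algebra actX X \<phi>"
proof -
  interpret X: G_space actX X by fact
  interpret Y: G_space actY Y by fact
  obtain p :: "'g measure" where p: "prob_space p" "sets p = sets borel"
      and shift: "\<And>P g. (AE h in p. P h) \<Longrightarrow> (AE h in p. P (h + g))"
    using exists_right_quasi_invariant_prob[OF lc] by metis
  interpret p: prob_space p by fact
  have [measurable_cong]: "sets p = sets borel" by fact
  have m: "\<pi> \<in> measurable X Y"
    using \<pi> by (rule G_map_measurable)
  have Fm: "F \<in> borel_measurable Y"
    using F by (simp add: Linfty_def)
  have minus: "uminus \<in> borel_measurable (borel :: 'g measure)"
    by (intro borel_measurable_continuous_onI) (auto simp: continuous_on_def intro: tendsto_minus tendsto_ident_at)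
  define k where "k x h = actY (- h) (\<pi> (actX h x))" for x h
  have "(\<lambda>w. k (fst w) (snd w)) \<in> measurable (X \<Otimes>\<^sub>M p) Y"
    unfolding k_def
    by (intro Y.measurable_act measurable_compose[OF _ m] X.measurable_act measurable_compose[OF _ minus]) auto
  then have Fk: "(\<lambda>(x, h). F (k x h)) \<in> borel_measurable (X \<Otimes>\<^sub>M p)"
    using measurable_compose[OF _ Fm] by (simp add: case_prod_unfold)
  define f where "f x = (\<integral>h. F (k x h) \<partial>p)" for x
  have f: "f \<in> borel_measurable X"
    unfolding f_def using Fk by (rule p.borel_measurable_lebesgue_integral)
  have f_eq: "f x = F c" if "x \<in> space X" "AE h in p. k x h = c" for x c
  proof -
    have "(\<lambda>h. F (k x h)) \<in> borel_measurable p"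
      using measurable_compose[OF measurable_Pair1'[OF that(1)] Fk] by simp
    moreover have "AE h in p. F (k x h) = F c"
      using that(2) by eventually_elim simp
    ultimately have "f x = (\<integral>h. F c \<partial>p)"
      unfolding f_def by (intro integral_cong_AE) auto
    then show ?thesis
      by (simp add: p.prob_space)
  qed
  have good: "AE x in X. f x = F (\<pi> x) \<and> (\<forall>g\<in>\<phi> x. f (actX g x) = f x)"
    using AE_AE_G_map_equivariant[OF X Y p \<pi>] sub AE_space
  proof eventually_elim
    case (elim x)
    have \<pi>x: "\<pi> x \<in> space Y"
      using elim(3) m by (rule measurable_space[rotated])
    have "AE h in p. k x h = \<pi> x"
      using elim(1) by eventually_elim (simp add: k_def Y.act_uminus_act[OF \<pi>x])
    then have fx: "f x = F (\<pi> x)"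
      by (rule f_eq[OF elim(3)])
    have "f (actX g x) = F (\<pi> x)" if "g \<in> \<phi> x" for g
    proof (rule f_eq)
      show "actX g x \<in> space X"
        using elim(3) by simp
      have "actY g (\<pi> x) = \<pi> x"
        using elim(2) that by (auto simp: stab_def)
      then have "actY (- h) (actY (h + g) (\<pi> x)) = \<pi> x" for h
        using Y.act_add[OF \<pi>x, of h g] Y.act_uminus_act[OF \<pi>x] by simp
      moreover have "AE h in p. \<pi> (actX (h + g) x) = actY (h + g) (\<pi> x)"
        using shift[OF elim(1), of g] .
      ultimately show "AE h in p. k (actX g x) h = \<pi> x"
        unfolding k_def X.act_add[OF elim(3), symmetric] by (auto elim!: eventually_mono)
    qed
    then show ?case
      using fx by simp
  qed
  have F\<pi>: "(\<lambda>x. F (\<pi> x)) \<in> Linfty X"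
    using \<pi> F by (rule Linfty_comp_G_map)
  then obtain C where bound: "AE x in X. \<bar>F (\<pi> x)\<bar> \<le> C"
    by (auto simp: Linfty_def)
  have "f \<in> Linfty X"
  proof -
    have "AE x in X. \<bar>f x\<bar> \<le> C"
      using bound good by eventually_elim simp
    then show ?thesis
      using f by (auto simp: Linfty_def)
  qed
  moreover have "AE x in X. F (\<pi> x) = f x"
    using good by eventually_elim simp
  moreover have "phi_invariant actX X \<phi> f"
    unfolding phi_invariant_def using good by eventually_elim simp
  ultimately show ?thesis
    using F\<pi> unfolding invariant_algebra_def by blast
qed

section \<open>Factoring through the quotient space\<close>

text \<open>The coordinates of \<open>\<pi> x\<close> are functions \<open>t i\<close> of \<open>\<psi> x\<close>.  On the measurable set \<open>Z0\<close> where these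
  functions are the coordinates of a point of \<open>Y\<close>, that point is the value of \<open>\<tau>\<close>; on its
  complement, a null set, the value is arbitrary.\<close>
lemma G_map_factorization:
  assumes X: "G_space actX X" and Z: "G_space actZ Z" and Y: "G_space actY Y"
    and \<psi>: "G_map actX X actZ Z \<psi>" and \<pi>: "G_map actX X actY Y \<pi>"
    and factor: "\<And>F. F \<in> Linfty Y \<Longrightarrow> \<exists>F'\<in>Linfty Z. AE x in X. F (\<pi> x) = F' (\<psi> x)"
  obtains \<tau> where "G_map actZ Z actY Y \<tau>" "AE x in X. \<tau> (\<psi> x) = \<pi> x"
proof -
  interpret X: G_space actX X by fact
  interpret Y: G_space actY Y by fact
  interpret Z: G_space actZ Z by fact
  have m\<pi>: "\<pi> \<in> measurable X Y" and m\<psi>: "\<psi> \<in> measurable X Z"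
    using \<pi> \<psi> by (auto intro: G_map_measurable)
  obtain d y where "standard_borel_metric Y d y"
    using standard_borel_imp_metric[OF Y.standard_borel Y.not_empty] by blast
  then interpret D: standard_borel_metric Y d y .
  have "\<exists>F'. F' \<in> borel_measurable Z \<and> (AE x in X. d (y i) (\<pi> x) = F' (\<psi> x))" for i
    using factor[OF D.dist_in_Linfty[OF D.centre]] by (auto simp: Linfty_def)
  then obtain t where t [measurable]: "\<And>i. t i \<in> borel_measurable Z"
      and t_eq: "\<And>i. AE x in X. d (y i) (\<pi> x) = t i (\<psi> x)"
    by metis
  \<comment> \<open>The three conditions are the hypotheses of \<open>point_with_prescribed_dists\<close>.\<close>
  define Z0 where "Z0 = {z \<in> space Z. (\<forall>i j. d (y i) (y j) \<le> t i z + t j z) \<and>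
      (\<forall>i j. t j z \<le> d (y i) (y j) + t i z) \<and> (\<forall>n. \<exists>i. t i z < 1 / real (Suc n))}"
  have Z0 [measurable]: "Z0 \<in> sets Z"
    unfolding Z0_def by measurable
  have "\<exists>a. (z \<in> Z0 \<longrightarrow> (a \<in> space Y \<and> (\<forall>j. d (y j) a = t j z))) \<and> (z \<notin> Z0 \<longrightarrow> a = y 0)" for z
  proof (cases "z \<in> Z0")
    case True
    then obtain a where "a \<in> space Y" "\<And>j. d (y j) a = t j z"
      using D.point_with_prescribed_dists[of "\<lambda>i. t i z"] unfolding Z0_def by blast
    then show ?thesis
      using True by blast
  qed auto
  then obtain \<tau> where \<tau>: "\<And>z. z \<in> Z0 \<Longrightarrow> \<tau> z \<in> space Y" "\<And>z j. z \<in> Z0 \<Longrightarrow> d (y j) (\<tau> z) = t j z"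
      "\<And>z. z \<notin> Z0 \<Longrightarrow> \<tau> z = y 0"
    by metis
  have m\<tau>: "\<tau> \<in> measurable Z Y"
  proof (rule D.measurable_if_dist_measurable)
    show "\<tau> z \<in> space Y" if "z \<in> space Z" for z
      using \<tau>(1,3)[of z] D.centre by (cases "z \<in> Z0") auto
    have "(\<lambda>z. d (y i) (\<tau> z)) = (\<lambda>z. if z \<in> Z0 then t i z else d (y i) (y 0))" for i
      using \<tau>(2,3) by (intro ext) auto
    then show "(\<lambda>z. d (y i) (\<tau> z)) \<in> borel_measurable Z" for i
      by simp
  qed
  have "AE x in X. \<forall>i. d (y i) (\<pi> x) = t i (\<psi> x)"
    using t_eq by (simp add: AE_all_countable)
  then have \<tau>\<psi>: "AE x in X. \<tau> (\<psi> x) = \<pi> x"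
    using AE_space
  proof eventually_elim
    case (elim x)
    have x: "\<pi> x \<in> space Y" "\<psi> x \<in> space Z"
      using measurable_space[OF m\<pi> elim(2)] measurable_space[OF m\<psi> elim(2)] .
    have "d (y i) (y j) \<le> d (y i) (\<pi> x) + d (y j) (\<pi> x)"
      "d (y j) (\<pi> x) \<le> d (y i) (y j) + d (y i) (\<pi> x)" for i j
      using D.triangle[of "y i" "\<pi> x" "y j"] D.triangle[of "y j" "y i" "\<pi> x"] D.centre x
        D.commute[of "\<pi> x" "y j"] D.commute[of "y j" "y i"] by auto
    moreover have "\<exists>i. d (y i) (\<pi> x) < 1 / real (Suc n)" for n
      using D.centres_dense[OF x(1), of "1 / real (Suc n)"] by simp
    ultimately have "\<psi> x \<in> Z0"
      using elim(1) x(2) unfolding Z0_def by simp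
    then show ?case
      using \<tau>(1,2) elim(1) x(1) by (intro D.eq_if_dist_eq) auto
  qed
  have "distr Z Y \<tau> = distr (distr X Z \<psi>) Y \<tau>"
    by (simp only: G_map_distr[OF \<psi>])
  also have "\<dots> = distr X Y (\<tau> \<circ> \<psi>)"
    by (rule distr_distr[OF m\<tau> m\<psi>])
  also have "\<dots> = distr X Y \<pi>"
    using \<tau>\<psi> measurable_compose[OF m\<psi> m\<tau>] m\<pi> by (intro distr_cong_AE) (auto simp: comp_def)
  also have "\<dots> = Y"
    using \<pi> by (rule G_map_distr)
  finally have distr: "distr Z Y \<tau> = Y" .
  have "AE z in Z. \<tau> (actZ g z) = actY g (\<tau> z)" for g
  proof -
    have "{z \<in> space Z. \<tau> (actZ g z) = actY g (\<tau> z)} \<in> sets Z"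
      by (rule standard_borel_eq_measurable[OF Y.standard_borel
          measurable_compose[OF Z.measurable_act_fixed m\<tau>]
          measurable_compose[OF m\<tau> Y.measurable_act_fixed]])
    moreover have "AE x in X. \<tau> (actZ g (\<psi> x)) = actY g (\<tau> (\<psi> x))"
    proof -
      have "AE x in X. \<psi> (actX g x) = actZ g (\<psi> x)" "AE x in X. \<pi> (actX g x) = actY g (\<pi> x)"
        using \<psi> \<pi> by (auto simp: G_map_def)
      then show ?thesis
        using \<tau>\<psi> X.AE_act[OF \<tau>\<psi>, of g] by eventually_elim metis
    qed
    ultimately have "AE z in distr X Z \<psi>. \<tau> (actZ g z) = actY g (\<tau> z)"
      by (simp add: AE_distr_iff[OF m\<psi>])
    then show ?thesis
      unfolding G_map_distr[OF \<psi>] .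
  qed
  then have "G_map actZ Z actY Y \<tau>"
    using m\<tau> distr by (simp add: G_map_def)
  then show ?thesis
    using that \<tau>\<psi> by blast
qed

theorem theorem4p10:
  fixes X :: "'x measure"
    and Z :: "'z measure"
    and actX :: "'g::{topological_group_add, second_countable_topology, t2_space} \<Rightarrow> 'x \<Rightarrow> 'x"
    and actZ :: "'g \<Rightarrow> 'z \<Rightarrow> 'z"
    and \<phi> :: "'x \<Rightarrow> 'g set"
    and \<psi> :: "'x \<Rightarrow> 'z"
  assumes "locally_compact_space (euclidean :: 'g topology)"
    and "G_space actX X"
    and "\<phi> \<in> measurable X chabauty_borel"
    and "\<forall>g. AE x in X. \<phi> (actX g x) = conj_subgroup g (\<phi> x)"
    and "AE x in X. stab actX x \<subseteq> \<phi> x"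
    and "quotient_space actX X \<phi> actZ Z \<psi>"
  shows "(AE x in X. \<phi> x \<subseteq> stab actZ (\<psi> x)) \<and>
    (\<forall>(Y :: 'y measure) (actY :: 'g \<Rightarrow> 'y \<Rightarrow> 'y) \<pi>.
       G_space actY Y \<longrightarrow> G_map actX X actY Y \<pi> \<longrightarrow>
       (AE x in X. \<phi> x \<subseteq> stab actY (\<pi> x)) \<longrightarrow>
       (\<exists>\<psi>' \<tau>. G_map actX X actZ Z \<psi>' \<and> (AE x in X. \<psi>' x = \<psi> x) \<and>
               G_map actZ Z actY Y \<tau> \<and> (AE x in X. \<tau> (\<psi>' x) = \<pi> x)))"
proof (intro conjI allI impI)
  have Z: "G_space actZ Z" and \<psi>: "G_map actX X actZ Z \<psi>"
    and algebra_eq: "invariant_algebra actX X \<phi>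
      = {f \<in> Linfty X. \<exists>F\<in>Linfty Z. AE x in X. f x = F (\<psi> x)}"
    using assms(6) by (auto simp: quotient_space_def)
  show "AE x in X. \<phi> x \<subseteq> stab actZ (\<psi> x)"
  proof (rule AE_subset_stab_if_invariant[OF assms(1,2) Z \<psi> assms(3,4)])
    fix F assume F: "F \<in> Linfty Z"
    then show "(\<lambda>x. F (\<psi> x)) \<in> invariant_algebra actX X \<phi>"
      unfolding algebra_eq using F Linfty_comp_G_map[OF \<psi> F] by auto
  qed
  fix Y :: "'y measure" and actY :: "'g \<Rightarrow> 'y \<Rightarrow> 'y" and \<pi>
  assume Y: "G_space actY Y" and \<pi>: "G_map actX X actY Y \<pi>"
    and sub: "AE x in X. \<phi> x \<subseteq> stab actY (\<pi> x)"
  have "\<exists>F'\<in>Linfty Z. AE x in X. F (\<pi> x) = F' (\<psi> x)" if "F \<in> Linfty Y" for F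
    using invariant_if_AE_subset_stab[OF assms(1,2) Y \<pi> sub that] unfolding algebra_eq by blast
  then obtain \<tau> where "G_map actZ Z actY Y \<tau>" "AE x in X. \<tau> (\<psi> x) = \<pi> x"
    using G_map_factorization[OF assms(2) Z Y \<psi> \<pi>] by blast
  then show "\<exists>\<psi>' \<tau>. G_map actX X actZ Z \<psi>' \<and> (AE x in X. \<psi>' x = \<psi> x) \<and>
      G_map actZ Z actY Y \<tau> \<and> (AE x in X. \<tau> (\<psi>' x) = \<pi> x)"
    using \<psi> by blast
qed

end
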